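(* Let $k\ge 1$ and $N=F_k=2^{2^k}+1$. Let $m$ be an integer coprime to $N$ which is a fourth power modulo $N$, and let $E: y^2=x^3-mx$, with points and group law computed modulo $N$. Let $P=(x,y)$ be a point on $E$ whose $x$-coordinate $x$ is a quadratic non-residue modulo $N$. Let $\eta=1+i$ be the endomorphism of $E$ described in the context. Then $N$ is prime if and only if $\eta^{2^k-1}P=(0,0)$.
   Context: Let $i\in\mathbb{Z}/N\mathbb{Z}$ denote a square root of $-1$ modulo $N$ (for $N=F_k$ one may take $i=2^{2^{k-1}}$). The map $[i](x,y)=(-x,iy)$ is an automorphism of $E:y^2=x^3-mx$, and $\eta=[1+i]$ is the endomorphism $\eta(x,y)=(x,y)+[i](x,y)$, where $+$ is the elliptic curve group law (identity $\infty$, the point at infinity). Explicitly, if $x\neq 0$, the $x$-coordinate of $\eta(x,y)$ is $x'=\left(\frac{(1-i)y}{2x}\right)^2=\frac{x^2-m}{2ix}$, and its $y$-coordinate is $\frac{(1-i)y}{2x}(x-x')-y$; the kernel of $\eta$ is $\{\infty,(0,0)\}$. $\eta^j$ denotes the $j$-fold iterate. When $N$ is composite, the statement $\eta^{2^k-1}P=(0,0)$ means that iterating these formulas with arithmetic in $\mathbb{Z}/N\mathbb{Z}$ yields the point $(0,0)$ (equivalently, the equality holds on the reduction of $E$ modulo each prime divisor of $N$).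
   Formalization: The formal theorem assumes k ≥ 2 instead of k ≥ 1, because the claim is false for k = 1: with N = 5, m = 1, i = 2, P = (2,1), N is prime and x = 2 is a non-residue, but ηP = (1,0) ≠ (0,0); every admissible instance with N = 5 fails. *)

theory Defs
  imports "HOL-Number_Theory.Number_Theory"
begin

text \<open>
  Residues modulo \<open>n\<close> are represented by the integers in \<open>{0..<n}\<close>. For composite \<open>n\<close> a division
  modulo \<open>n\<close>, and hence the addition of points, can fail; \<open>None\<close> means that a denominator is not
  invertible modulo \<open>n\<close>. For prime \<open>n\<close> not dividing \<open>2 * m\<close>, addition is total on the points
  of the curve and is the usual group law.
\<close>

definition div_mod :: "int \<Rightarrow> int \<Rightarrow> int \<Rightarrow> int option" where
  "div_mod n a b = (if coprime b n then Some ((a * modular_inverse n b) mod n) else None)"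

datatype point = Infinity | Affine int int

definition ec_points :: "int \<Rightarrow> int \<Rightarrow> point set" where
  "ec_points n m = insert Infinity
     {Affine x y | x y. x \<in> {0..<n} \<and> y \<in> {0..<n} \<and> [y ^ 2 = x ^ 3 - m * x] (mod n)}"

fun ec_slope :: "int \<Rightarrow> int \<Rightarrow> int \<times> int \<Rightarrow> int \<times> int \<Rightarrow> int option" where
  "ec_slope n m (x1, y1) (x2, y2) =
     (if [x1 = x2] (mod n) \<and> [y1 = y2] (mod n)
      then div_mod n (3 * x1 ^ 2 - m) (2 * y1)
      else div_mod n (y2 - y1) (x2 - x1))"

fun ec_add :: "int \<Rightarrow> int \<Rightarrow> point \<Rightarrow> point \<Rightarrow> point option" where
  "ec_add n m Infinity Q = Some Q"
| "ec_add n m P Infinity = Some P"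
| "ec_add n m (Affine x1 y1) (Affine x2 y2) =
     (if [x1 = x2] (mod n) \<and> [y1 = - y2] (mod n) then Some Infinity
      else map_option
        (\<lambda>l. let x3 = l ^ 2 - x1 - x2 in Affine (x3 mod n) ((l * (x1 - x3) - y1) mod n))
        (ec_slope n m (x1, y1) (x2, y2)))"

fun ec_i :: "int \<Rightarrow> int \<Rightarrow> point \<Rightarrow> point" where
  "ec_i n i Infinity = Infinity"
| "ec_i n i (Affine x y) = Affine ((- x) mod n) ((i * y) mod n)"

definition eta :: "int \<Rightarrow> int \<Rightarrow> int \<Rightarrow> point \<Rightarrow> point option" where
  "eta n m i P = ec_add n m P (ec_i n i P)"

definition eta_iter :: "int \<Rightarrow> int \<Rightarrow> int \<Rightarrow> nat \<Rightarrow> point \<Rightarrow> point option" where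
  "eta_iter n m i j P = ((\<lambda>Q. Option.bind Q (eta n m i)) ^^ j) (Some P)"

lemma eta_Affine:
  fixes n m i x y :: int
  assumes n: "n > 1" and i: "[i ^ 2 = - 1] (mod n)" and x: "coprime (2 * x) n"
  defines "l \<equiv> (1 - i) * y * modular_inverse n (2 * x)"
  shows "eta n m i (Affine x y) =
    Some (Affine (l ^ 2 mod n) ((l * (x - l ^ 2) - y) mod n))"
proof -
  define x' where "x' = (- x) mod n"
  define y' where "y' = (i * y) mod n"
  define s where "s = (y' - y) * modular_inverse n (x' - x)"
  have x': "[x' = - x] (mod n)" and y': "[y' = i * y] (mod n)"
    by (simp_all add: x'_def y'_def)
  have d: "[x' - x = - (2 * x)] (mod n)"
    using cong_diff[OF x' cong_refl[of x]] by simp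
  have cop: "coprime (x' - x) n"
    using x d by (metis cong_imp_coprime cong_sym coprime_minus_left_iff)
  have ne: "\<not> [x = x'] (mod n)"
  proof
    assume "[x = x'] (mod n)"
    then have "n dvd x' - x" by (metis cong_iff_dvd_diff cong_sym)
    then have "is_unit n" using cop by (meson coprime_common_divisor dvd_refl)
    with n show False by (simp add: zdvd1_eq)
  qed
  have "[- (modular_inverse n (2 * x)) * (- (2 * x)) = 1] (mod n)"
    using cong_modular_inverse2[OF x] by simp
  moreover have "[modular_inverse n (x' - x) * (x' - x) = 1] (mod n)"
    by (rule cong_modular_inverse2[OF cop])
  ultimately have "[modular_inverse n (x' - x) * (x' - x) = - (modular_inverse n (2 * x)) * (x' - x)] (mod n)"
    by (meson d cong_scalar_left cong_sym cong_trans)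
  then have inv: "[modular_inverse n (x' - x) = - modular_inverse n (2 * x)] (mod n)"
    using cop by (simp only: cong_mult_rcancel)
  have "[y' - y = i * y - y] (mod n)" by (intro cong_diff y' cong_refl)
  then have "[s = (i * y - y) * (- modular_inverse n (2 * x))] (mod n)"
    unfolding s_def by (intro cong_mult inv)
  then have s: "[s = l] (mod n)"
    by (simp add: l_def algebra_simps)
  have sm: "[s mod n = l] (mod n)" using s by simp
  have X: "[(s mod n) ^ 2 - x - x' = l ^ 2] (mod n)"
    using cong_diff[OF cong_diff[OF cong_pow[OF sm, of 2] cong_refl[of x]] x'] by simp
  have Y: "[(s mod n) * (x - ((s mod n) ^ 2 - x - x')) - y = l * (x - l ^ 2) - y] (mod n)"
    by (intro cong_diff cong_mult X sm cong_refl)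
  show ?thesis
    using ne cop X Y
    by (simp add: eta_def div_mod_def Let_def cong_def flip: x'_def y'_def s_def)
qed

text \<open>
  The primality criterion for \<open>2 ^ 2 ^ k + 1\<close> has to exclude \<open>k = 1\<close>: modulo the prime \<open>5\<close>, all
  hypotheses hold for \<open>m = 1\<close>, \<open>i = 2\<close> and the point \<open>(2, 1)\<close>, but \<open>eta\<close> maps it to \<open>(1, 0)\<close>.
\<close>

lemma Fermat_5_counterexample:
  "prime (2 ^ 2 ^ 1 + 1 :: int)" "coprime (1 :: int) 5" "[1 ^ 4 = 1 :: int] (mod 5)"
  "[2 ^ 2 = - 1 :: int] (mod 5)" "Affine 2 1 \<in> ec_points 5 1" "\<not> QuadRes 5 2"
  "eta_iter 5 1 2 (2 ^ 1 - 1) (Affine 2 1) = Some (Affine 1 0)"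
proof -
  show "prime (2 ^ 2 ^ 1 + 1 :: int)" by simp
  show "\<not> QuadRes 5 2"
  proof
    assume "QuadRes 5 2"
    then obtain y :: int where "y ^ 2 mod 5 = 2" by (auto simp: QuadRes_def cong_def)
    moreover have "y mod 5 \<in> {0, 1, 2, 3, 4}" by auto
    ultimately show False by (auto simp: power_mod[of y 5 2, symmetric])
  qed
  have "modular_inverse 5 (1 :: int) = 1"
    by (rule modular_inverse_int_eqI) auto
  then show "eta_iter 5 1 2 (2 ^ 1 - 1) (Affine 2 1) = Some (Affine 1 0)"
    by (simp add: eta_iter_def eta_def div_mod_def cong_def)
qed (auto simp: ec_points_def cong_def)

end

theory Submission
  imports Defs
begin

text \<open>
  Let \<open>q\<close> be a prime and \<open>T = (0, 0)\<close>. The map \<open>eta\<close> preserves collinearity of points; hence, if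
  \<open>T\<close> is an \<open>eta ^^ j\<close>-image, the set of \<open>eta ^^ j\<close>-images is closed under translation by \<open>T\<close>. As
  the nonempty fibres of \<open>eta\<close> are the pairs \<open>{P, P + T}\<close>, the number of points is then
  \<open>2 ^ (j + 1)\<close> times the number of \<open>eta ^^ (j + 1)\<close>-images, and that cofactor is odd (negation
  fixes only \<open>Infinity\<close>) for the largest such \<open>j\<close>. Collinearity suffices for this:
  associativity of the addition is never used.

  If \<open>N = 2 ^ 2 ^ k + 1\<close> is prime, Jacobsthal's identity for the sums of \<open>Legendre (x ^ 3 - u * x)\<close>
  writes \<open>N\<close> as a sum of two squares. This leaves only four candidates for the number of points,
  and divisibility by 8 singles out \<open>N - 1 = 2 ^ 2 ^ k\<close>. So \<open>eta\<close> is nilpotent with all its chains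
  as long as possible, and a point with nonresidue \<open>x\<close>, which is no \<open>eta\<close>-image, reaches \<open>T\<close> after
  exactly \<open>2 ^ k - 1\<close> steps. If \<open>N\<close> is composite, reduction modulo a prime \<open>q \<le> sqrt N\<close> would
  give at least \<open>2 ^ 2 ^ k\<close> points on a curve having at most \<open>2 * q + 1\<close> of them.
\<close>

section \<open>Sums of two squares, small divisors, involutions\<close>

text \<open>A prime is a sum of two squares in essentially one way. Here the prime divides
  \<open>(a*d - b) * (a*d + b)\<close>; replacing \<open>b\<close> by \<open>- b\<close> if
  necessary, it divides the first factor.\<close>

lemma sum_two_squares_one_plus_square:
  fixes a b d :: int
  assumes "a^2 + b^2 = d^2 + 1" "prime (d^2 + 1)"
  shows "\<bar>a\<bar> = 1 \<or> \<bar>a\<bar> = \<bar>d\<bar>"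
proof -
  let ?p = "d^2 + 1"
  have p: "?p > 1" using assms(2) prime_gt_1_int by blast
  have main: "\<bar>a\<bar> = 1 \<or> \<bar>a\<bar> = \<bar>d\<bar>" if ab: "a^2 + b^2 = ?p" and dvd: "?p dvd a*d - b" for b
  proof -
    obtain k where k: "a*d - b = ?p * k" using dvd by blast
    \<comment> \<open>This is the norm of the product of the Gaussian integers a + bi and d + i. The
      right-hand side is the square of the prime and \<open>a*d - b\<close> is a multiple of it, so
      one of the squares on the left must vanish.\<close>
    have "(a*d - b)^2 + (a + b*d)^2 = (a^2 + b^2) * ?p" by Groebner_Basis.algebra
    then have eq: "(?p * k)^2 + (a + b*d)^2 = ?p^2" using ab k by (simp add: power2_eq_square)
    show ?thesis
    proof (cases "k = 0")
      case True
      then have "b = a*d" using k by simp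
      then have "a^2 * ?p = ?p" using ab by (simp add: power_mult_distrib distrib_left)
      then show ?thesis using p by (auto simp: power2_eq_1_iff)
    next
      case False
      then have "k^2 \<ge> 1" by (simp add: int_one_le_iff_zero_less)
      then have "?p^2 * k^2 \<ge> ?p^2" using mult_left_mono[of 1 "k^2" "?p^2"] by simp
      then have "(a + b*d)^2 \<le> 0" using eq unfolding power_mult_distrib by linarith
      then have a: "a = - b*d" by simp
      then have "b^2 * ?p = ?p" using ab by (simp add: power_mult_distrib distrib_left)
      then have "\<bar>b\<bar> = 1" using p by (auto simp: power2_eq_1_iff)
      then show ?thesis using a by (simp add: abs_mult)
    qed
  qed
  have "(a*d - b) * (a*d + b) = a^2 * ?p - (a^2 + b^2)" by Groebner_Basis.algebra
  then have "?p dvd (a*d - b) * (a*d + b)" using assms(1) by simp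
  then consider "?p dvd a*d - b" | "?p dvd a*d - (- b)"
    using assms(2) by (auto simp: prime_dvd_mult_iff)
  then show ?thesis using main[of b] main[of "- b"] assms(1) by cases auto
qed

lemma even_if_sum_squares_dvd_4:
  fixes a b n :: int
  assumes "a^2 + b^2 = 4 * n"
  shows "even a"
proof (rule ccontr)
  assume "odd a"
  moreover have "even (a^2 + b^2)" using assms by simp
  ultimately have "odd a" "odd b" by simp_all
  then obtain x y where "a = 2*x + 1" "b = 2*y + 1" by (auto elim!: oddE)
  then have "4 * (x^2 + x + y^2 + y) + 2 = 4 * n"
    using assms by (simp add: power2_eq_square algebra_simps)
  then show False by presburger
qed

lemma small_prime_divisor:
  fixes n :: int
  assumes "n > 1" "\<not> prime n"
  obtains q where "prime q" "q dvd n" "q^2 \<le> n"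
proof -
  obtain p where p: "prime p" "p dvd n"
    using assms(1) prime_divisor_exists[of n] by auto
  then obtain s where s: "n = p * s" by blast
  have p1: "p > 1" using p(1) by (rule prime_gt_1_int)
  have "s > 0" using s assms(1) p1 by (metis less_trans zero_less_mult_pos zero_less_one)
  moreover have "s \<noteq> 1" using s assms(2) p(1) by auto
  ultimately have "s > 1" by simp
  show thesis
  proof (cases "p \<le> s")
    case True
    then have "p^2 \<le> n" using p1 s by (simp add: power2_eq_square)
    then show thesis using that p by blast
  next
    case False
    obtain q where q: "prime q" "q dvd s"
      using \<open>s > 1\<close> prime_divisor_exists[of s] by auto
    then have "q > 1" "q \<le> s" using \<open>s > 1\<close> by (auto intro: prime_gt_1_int zdvd_imp_le)
    then have "q * q \<le> p * s" using False p1 by (intro mult_mono) auto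
    then show thesis using that[of q] q s by (simp add: power2_eq_square)
  qed
qed

lemma even_card_involution:
  assumes "finite A" "\<And>a. a \<in> A \<Longrightarrow> f a \<in> A" "\<And>a. a \<in> A \<Longrightarrow> f (f a) = a"
    and "\<And>a. a \<in> A \<Longrightarrow> f a \<noteq> a"
  shows "even (card A)"
  using assms
proof (induction "card A" arbitrary: A rule: less_induct)
  case less
  show ?case
  proof (cases "A = {}")
    case False
    then obtain a where a: "a \<in> A" by blast
    let ?B = "A - {a, f a}"
    have "card {a, f a} = 2" using less.prems(4)[OF a] by auto
    moreover have "{a, f a} \<subseteq> A" using a less.prems(2) by simp
    ultimately have card: "card A = card ?B + 2"
      using less.prems(1) by (metis card_Diff_subset card_mono finite_subset le_add_diff_inverse2)
    have "f b \<in> ?B" if "b \<in> ?B" for b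
      using that less.prems(2,3) by (metis Diff_iff insertCI insertE empty_iff a)
    then have "even (card ?B)"
      using card less.prems by (intro less.hyps) auto
    then show ?thesis using card by simp
  qed simp
qed

section \<open>Jacobsthal sums\<close>

text \<open>For a prime \<open>q > 2\<close> this is the number of points of
  \<open>y^2 = x^3 - u*x\<close> modulo \<open>q\<close>, infinity included, minus
  \<open>q + 1\<close>; on a nonsingular curve it is the negated trace of Frobenius.\<close>

definition jacobsthal :: "int \<Rightarrow> int \<Rightarrow> int" where
  "jacobsthal q u = (\<Sum>x\<in>{0..<q}. Legendre (x^3 - u*x) q)"

context
  fixes q :: int
  assumes prime_q: "prime q" and q_gt_2: "2 < q"
begin

lemma Legendre_cong: "[a = b] (mod q) \<Longrightarrow> Legendre a q = Legendre b q"
  by (simp add: Legendre_def QuadRes_def cong_def)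

lemma Legendre_mod [simp]: "Legendre (a mod q) q = Legendre a q"
  by (rule Legendre_cong) simp

lemma Legendre_cases: "Legendre a q = - 1 \<or> Legendre a q = 0 \<or> Legendre a q = 1"
  by (simp add: Legendre_def)

lemma Legendre_eq_0_iff: "Legendre a q = 0 \<longleftrightarrow> q dvd a"
  by (simp add: Legendre_def cong_0_iff)

text \<open>As \<open>q > 2\<close>, the values -1, 0 and 1 are distinct modulo \<open>q\<close>.
  This turns Euler's criterion, a congruence, into equalities of symbols.\<close>

lemma Legendre_unique:
  assumes "[s = t] (mod q)" "\<bar>s\<bar> \<le> 1" "\<bar>t\<bar> \<le> 1"
  shows "s = t"
proof -
  have "q dvd s - t" "\<bar>s - t\<bar> < q" using assms q_gt_2 by (simp_all add: cong_iff_dvd_diff)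
  then show ?thesis using dvd_imp_le_int[of "s - t" q] q_gt_2 by auto
qed

lemma Legendre_mult: "Legendre (a * b) q = Legendre a q * Legendre b q"
proof -
  define p where "p = nat q"
  have p: "prime p" "2 < p" "q = int p" using prime_q q_gt_2 by (auto simp: p_def)
  note euler = euler_criterion[OF p(1,2), folded p(3)]
  have "[Legendre a q * Legendre b q = a ^ ((p - 1) div 2) * b ^ ((p - 1) div 2)] (mod q)"
    by (intro cong_mult euler)
  then have "[Legendre (a * b) q = Legendre a q * Legendre b q] (mod q)"
    using euler[of "a * b"] by (metis cong_sym cong_trans power_mult_distrib)
  then show ?thesis
    using Legendre_cases[of a] Legendre_cases[of b] Legendre_cases[of "a * b"]
    by (intro Legendre_unique) auto
qed

lemma Legendre_square: "\<not> q dvd a \<Longrightarrow> Legendre (a^2) q = 1"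
  using cong_refl[of "a^2" q]
  by (auto simp: Legendre_def QuadRes_def cong_0_iff prime_dvd_power_iff[OF prime_q] simp del: cong_refl)

lemma Legendre_mult_self: "Legendre a q * Legendre a q = (if q dvd a then 0 else 1)"
  using Legendre_eq_0_iff Legendre_square[of a]
  by (auto simp flip: Legendre_mult simp: power2_eq_square)

lemma sum_residues_shift:
  fixes f :: "int \<Rightarrow> 'b::comm_monoid_add"
  assumes "\<And>x. f (x mod q) = f x"
  shows "(\<Sum>x\<in>{0..<q}. f (x + d)) = (\<Sum>x\<in>{0..<q}. f x)"
proof -
  have inj: "inj_on (\<lambda>x. (x + d) mod q) {0..<q}"
  proof (rule inj_onI)
    fix x y assume "x \<in> {0..<q}" "y \<in> {0..<q}" "(x + d) mod q = (y + d) mod q"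
    then show "x = y" by (metis atLeastLessThan_iff cong_add_rcancel cong_def mod_pos_pos_trivial)
  qed
  have "(\<lambda>x. (x + d) mod q) ` {0..<q} = {0..<q}"
    using q_gt_2 by (intro endo_inj_surj inj) auto
  then have "bij_betw (\<lambda>x. (x + d) mod q) {0..<q} {0..<q}" using inj by (simp add: bij_betw_def)
  from sum.reindex_bij_betw[OF this, of f] show ?thesis using assms by simp
qed

lemma sum_residues_scale:
  fixes f :: "int \<Rightarrow> 'b::comm_monoid_add"
  assumes "\<And>x. f (x mod q) = f x" "\<not> q dvd t"
  shows "(\<Sum>x\<in>{0..<q}. f (t * x)) = (\<Sum>x\<in>{0..<q}. f x)"
proof -
  have cop: "coprime t q"
    using assms(2) prime_q by (simp add: prime_imp_coprime coprime_commute)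
  have inj: "inj_on (\<lambda>x. (t * x) mod q) {0..<q}"
  proof (rule inj_onI)
    fix x y assume xy: "x \<in> {0..<q}" "y \<in> {0..<q}" "(t * x) mod q = (t * y) mod q"
    then have "[x = y] (mod q)" using cop cong_mult_lcancel[of t q x y] by (simp add: cong_def)
    then show "x = y" using xy by (simp add: cong_def)
  qed
  have "(\<lambda>x. (t * x) mod q) ` {0..<q} = {0..<q}"
    using q_gt_2 by (intro endo_inj_surj inj) auto
  then have "bij_betw (\<lambda>x. (t * x) mod q) {0..<q} {0..<q}" using inj by (simp add: bij_betw_def)
  from sum.reindex_bij_betw[OF this, of f] show ?thesis using assms by simp
qed

lemma dvd_residue_iff: "x \<in> {0..<q} \<Longrightarrow> q dvd x \<longleftrightarrow> x = 0"
  using zdvd_not_zless[of x q] by (cases "x = 0") auto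

lemma sum_nonzero_residues: "(\<Sum>x\<in>{0..<q}. if q dvd x then 0 else a) = (q - 1) * a"
proof -
  have "(\<Sum>x\<in>{0..<q}. if q dvd x then 0 else a) = (\<Sum>x\<in>{0..<q}. if x = 0 then 0 else a)"
    by (intro sum.cong) (simp_all add: dvd_residue_iff)
  also have "\<dots> = (\<Sum>x\<in>{0..<q} - {0}. a)"
    by (simp add: sum.remove[of "{0..<q}" 0] q_gt_2 order_less_trans[OF _ q_gt_2])
  finally show ?thesis using q_gt_2 by simp
qed

lemma Legendre_scale_pair: "Legendre (t*x*(t*x + t*d)) q = (if q dvd t then 0 else Legendre (x*(x + d)) q)"
proof -
  have "t*x*(t*x + t*d) = (t*t)*(x*(x + d))" by (simp add: algebra_simps)
  then show ?thesis by (simp only: Legendre_mult Legendre_mult_self) simp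
qed

text \<open>Substituting \<open>t*x\<close> for \<open>x\<close> pulls out the factor
  \<open>t^3\<close>, whose symbol is that of \<open>t\<close>.\<close>

lemma jacobsthal_scale:
  assumes "\<not> q dvd t"
  shows "jacobsthal q (t^2 * u) = Legendre t q * jacobsthal q u"
proof -
  have "jacobsthal q (t^2 * u) = (\<Sum>x\<in>{0..<q}. Legendre ((t*x)^3 - t^2*u*(t*x)) q)"
    unfolding jacobsthal_def using assms
    by (intro sum_residues_scale[symmetric] Legendre_cong cong_diff cong_mult cong_pow) simp_all
  also have "\<dots> = (\<Sum>x\<in>{0..<q}. Legendre ((t*t)*(t*(x^3 - u*x))) q)"
    by (simp add: algebra_simps power2_eq_square power3_eq_cube)
  also have "\<dots> = (\<Sum>x\<in>{0..<q}. Legendre t q * Legendre (x^3 - u*x) q)"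
    using assms by (simp only: Legendre_mult[of "t*t"] Legendre_mult[of t] Legendre_mult_self) simp
  finally show ?thesis by (simp add: jacobsthal_def sum_distrib_left)
qed

lemma jacobsthal_cong: "[u = v] (mod q) \<Longrightarrow> jacobsthal q u = jacobsthal q v"
  unfolding jacobsthal_def by (intro sum.cong refl Legendre_cong cong_diff cong_mult cong_refl)

text \<open>The two sums agree up to sign, so the square depends only on the class of
  \<open>u\<close> modulo nonzero squares. The two multipliers \<open>s\<close> and \<open>t\<close>
  avoid inverses.\<close>

lemma jacobsthal_square:
  assumes "\<not> q dvd s" "\<not> q dvd t" "[s^2 * u = t^2 * v] (mod q)"
  shows "(jacobsthal q u)^2 = (jacobsthal q v)^2"
proof -
  have "Legendre s q * jacobsthal q u = Legendre t q * jacobsthal q v"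
    using jacobsthal_cong[OF assms(3)] jacobsthal_scale assms(1,2) by simp
  moreover have "(Legendre s q)^2 = 1" "(Legendre t q)^2 = 1"
    using Legendre_mult_self assms by (simp_all add: power2_eq_square)
  ultimately show ?thesis by (metis mult_1 power_mult_distrib)
qed

lemma sum_equal_squares:
  assumes "x \<in> {0..<q}"
  shows "(\<Sum>y\<in>{0..<q}. if q dvd x^2 - y^2 then Legendre y q else 0) = Legendre x q + Legendre (- x) q"
proof -
  have iff: "q dvd x^2 - y^2 \<longleftrightarrow> q dvd y - x \<or> q dvd y + x" for y
  proof -
    have "x^2 - y^2 = - ((y - x) * (y + x))" by (simp add: algebra_simps power2_eq_square)
    then show ?thesis by (simp add: prime_dvd_mult_iff[OF prime_q])
  qed
  have set: "{y \<in> {0..<q}. q dvd x^2 - y^2} = {x, (- x) mod q}"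
  proof (intro equalityI subsetI)
    fix y assume "y \<in> {y \<in> {0..<q}. q dvd x^2 - y^2}"
    then consider "[y = x] (mod q)" "y \<in> {0..<q}" | "[y = - x] (mod q)" "y \<in> {0..<q}"
      by (auto simp: iff cong_iff_dvd_diff)
    then show "y \<in> {x, (- x) mod q}" using assms by cases (auto simp: cong_def)
  next
    fix y assume "y \<in> {x, (- x) mod q}"
    moreover have "[(- x) mod q = - x] (mod q)" by simp
    ultimately show "y \<in> {y \<in> {0..<q}. q dvd x^2 - y^2}"
      using assms q_gt_2 by (auto simp: iff cong_iff_dvd_diff)
  qed
  have "(\<Sum>y\<in>{0..<q}. if q dvd x^2 - y^2 then Legendre y q else 0) =
      (\<Sum>y\<in>{x, (- x) mod q}. Legendre y q)"
    unfolding set[symmetric] by (rule sum.inter_filter[symmetric]) simp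
  also have "\<dots> = Legendre x q + Legendre (- x) q"
  proof (cases "x = (- x) mod q")
    \<comment> \<open>Only \<open>x = 0\<close> equals its own negative. Both symbols vanish there,
      so counting this root once does no harm.\<close>
    case True
    then have "q dvd 2 * x" by (metis cong_def cong_iff_dvd_diff diff_minus_eq_add mod_mod_trivial mult_2)
    then have "q dvd x" using prime_q q_gt_2 by (auto simp: prime_dvd_mult_iff dest: zdvd_imp_le)
    then have "Legendre x q = 0" "Legendre (- x) q = 0" by (simp_all add: Legendre_eq_0_iff)
    then show ?thesis using True[symmetric] by simp
  next
    case False
    then show ?thesis by simp
  qed
  finally show ?thesis .
qed

section \<open>Second moment of the Jacobsthal sums\<close>

context
  fixes g :: int
  assumes nonresidue: "\<not> QuadRes q g"
begin

lemma nonresidue_not_dvd: "\<not> q dvd g"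
proof
  assume "q dvd g"
  then have "[0^2 = g] (mod q)" by (simp add: cong_iff_dvd_diff)
  then show False using nonresidue unfolding QuadRes_def by blast
qed

lemma Legendre_nonresidue: "Legendre g q = - 1"
  using nonresidue nonresidue_not_dvd by (simp add: Legendre_def cong_0_iff)

text \<open>Multiplication by the nonresidue \<open>g\<close> permutes the residues and negates
  every symbol.\<close>

lemma sum_Legendre: "(\<Sum>x\<in>{0..<q}. Legendre x q) = 0"
proof -
  have "(\<Sum>x\<in>{0..<q}. Legendre (g * x) q) = (\<Sum>x\<in>{0..<q}. Legendre x q)"
    using nonresidue_not_dvd by (intro sum_residues_scale) simp_all
  then show ?thesis
    by (simp add: Legendre_mult Legendre_nonresidue sum_negf)
qed

text \<open>
  Scaling shows that the sum only depends on whether \<open>q\<close> divides \<open>d\<close>, and the sum over all \<open>d\<close>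
  vanishes.
\<close>

lemma sum_Legendre_pair:
  "(\<Sum>x\<in>{0..<q}. Legendre (x*(x + d)) q) = (if q dvd d then q else 0) - 1"
proof -
  define K where "K d = (\<Sum>x\<in>{0..<q}. Legendre (x*(x + d)) q)" for d
  have K_cong: "K d = K d'" if "[d = d'] (mod q)" for d d'
    unfolding K_def by (intro sum.cong Legendre_cong cong_mult cong_add that cong_refl refl)
  have K0: "K 0 = q - 1"
    unfolding K_def using sum_nonzero_residues[of 1]
    by (simp add: Legendre_mult Legendre_mult_self if_distrib cong: if_cong)
  have K1: "K d = K 1" if "\<not> q dvd d" for d
  proof -
    have "K d = (\<Sum>x\<in>{0..<q}. Legendre ((d*x)*(d*x + d)) q)"
      unfolding K_def using that
      by (intro sum_residues_scale[symmetric] Legendre_cong cong_mult cong_add) simp_all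
    also have "\<dots> = K 1"
      unfolding K_def using Legendre_scale_pair[of d _ 1] that by simp
    finally show ?thesis .
  qed
  have "(\<Sum>d\<in>{0..<q}. K d) = (\<Sum>x\<in>{0..<q}. \<Sum>d\<in>{0..<q}. Legendre (x*(x + d)) q)"
    unfolding K_def by (rule sum.swap)
  also have "\<dots> = (\<Sum>x\<in>{0..<q}. Legendre x q * (\<Sum>d\<in>{0..<q}. Legendre (d + x) q))"
    by (simp add: Legendre_mult sum_distrib_left add.commute)
  also have "\<dots> = 0"
    using sum_residues_shift[of "\<lambda>x. Legendre x q"] by (simp add: sum_Legendre)
  finally have "0 = (\<Sum>d\<in>{0..<q}. K d)" by simp
  also have "\<dots> = (\<Sum>d\<in>{0..<q}. (if q dvd d then 0 else K 1) + (if d = 0 then K 0 else 0))"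
  proof (intro sum.cong refl)
    fix d assume "d \<in> {0..<q}"
    then show "K d = (if q dvd d then 0 else K 1) + (if d = 0 then K 0 else 0)"
      using K1[of d] dvd_residue_iff[of d] by (cases "d = 0") simp_all
  qed
  also have "\<dots> = (q - 1) * K 1 + K 0"
    using q_gt_2 by (simp only: sum.distrib sum_nonzero_residues) simp
  finally have "(q - 1) * (K 1 + 1) = 0" unfolding K0 by (simp add: distrib_left)
  then have "K 1 = - 1" using q_gt_2 by simp
  then show ?thesis
    using K0 K1[of d] K_cong[of d 0] by (auto simp: K_def cong_0_iff)
qed

lemma jacobsthal_zero: "q dvd u \<Longrightarrow> jacobsthal q u = 0"
proof -
  assume "q dvd u"
  then have "jacobsthal q u = jacobsthal q 0" by (intro jacobsthal_cong) (simp add: cong_0_iff)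
  also have "\<dots> = (\<Sum>x\<in>{0..<q}. Legendre x q)"
    unfolding jacobsthal_def
    by (intro sum.cong) (auto simp: power3_eq_cube Legendre_mult Legendre_mult_self Legendre_eq_0_iff)
  finally show ?thesis by (simp add: sum_Legendre)
qed

text \<open>Expand the square and sum over \<open>u\<close> first: a pair \<open>x\<close>,
  \<open>y\<close> gets the weight \<open>q - 1\<close> if \<open>x^2\<close> and \<open>y^2\<close>
  agree modulo \<open>q\<close>, and \<open>- 1\<close> otherwise. The constant \<open>- 1\<close>
  contributes nothing because the symbols sum to 0. What remains is \<open>y = x\<close> and
  \<open>y = - x\<close>, with equal symbols since \<open>- 1\<close> is a square.\<close>

lemma sum_jacobsthal_square:
  assumes "QuadRes q (- 1)"
  shows "(\<Sum>u\<in>{0..<q}. (jacobsthal q u)^2) = 2 * q * (q - 1)"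
proof -
  have minus: "Legendre (- x) q = Legendre x q" for x
  proof -
    have "Legendre (- 1) q = 1"
      using assms q_gt_2 by (auto simp: Legendre_def cong_0_iff)
    then show ?thesis using Legendre_mult[of "- 1" x] by simp
  qed
  have inner: "(\<Sum>u\<in>{0..<q}. Legendre ((x^2 - u)*(y^2 - u)) q) =
      (if q dvd x^2 - y^2 then q else 0) - 1" for x y
  proof -
    \<comment> \<open>Shifting \<open>u\<close> by \<open>x^2\<close> brings the product into the
      form \<open>u * (u + d)\<close> of \<open>sum_Legendre_pair\<close>.\<close>
    have "(\<Sum>u\<in>{0..<q}. Legendre ((x^2 - u)*(y^2 - u)) q) =
        (\<Sum>u\<in>{0..<q}. Legendre ((x^2 - (u + x^2))*(y^2 - (u + x^2))) q)"
      by (intro sum_residues_shift[symmetric] Legendre_cong cong_diff cong_mult) simp_all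
    also have "\<dots> = (\<Sum>u\<in>{0..<q}. Legendre (u * (u + (x^2 - y^2))) q)"
      by (simp add: algebra_simps)
    finally show ?thesis by (simp only: sum_Legendre_pair)
  qed
  have "(jacobsthal q u)^2 = (\<Sum>x\<in>{0..<q}. \<Sum>y\<in>{0..<q}.
      Legendre x q * Legendre y q * Legendre ((x^2 - u)*(y^2 - u)) q)" for u
  proof -
    have "x^3 - u*x = x * (x^2 - u)" for x
      by (simp add: algebra_simps power2_eq_square power3_eq_cube)
    then show ?thesis
      unfolding jacobsthal_def power2_eq_square[of "sum _ _"] sum_product
      by (simp add: Legendre_mult mult_ac)
  qed
  then have "(\<Sum>u\<in>{0..<q}. (jacobsthal q u)^2) = (\<Sum>u\<in>{0..<q}. \<Sum>x\<in>{0..<q}. \<Sum>y\<in>{0..<q}.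
      Legendre x q * Legendre y q * Legendre ((x^2 - u)*(y^2 - u)) q)" by simp
  also have "\<dots> = (\<Sum>x\<in>{0..<q}. \<Sum>u\<in>{0..<q}. \<Sum>y\<in>{0..<q}.
      Legendre x q * Legendre y q * Legendre ((x^2 - u)*(y^2 - u)) q)"
    by (rule sum.swap)
  also have "\<dots> = (\<Sum>x\<in>{0..<q}. \<Sum>y\<in>{0..<q}. \<Sum>u\<in>{0..<q}.
      Legendre x q * Legendre y q * Legendre ((x^2 - u)*(y^2 - u)) q)"
    by (intro sum.cong refl sum.swap)
  also have "\<dots> = (\<Sum>x\<in>{0..<q}. \<Sum>y\<in>{0..<q}.
      Legendre x q * Legendre y q * ((if q dvd x^2 - y^2 then q else 0) - 1))"
    by (simp only: sum_distrib_left[symmetric] inner)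
  also have "\<dots> = (\<Sum>x\<in>{0..<q}. \<Sum>y\<in>{0..<q}.
      q * Legendre x q * (if q dvd x^2 - y^2 then Legendre y q else 0) - Legendre x q * Legendre y q)"
    by (intro sum.cong refl) (simp add: algebra_simps)
  also have "\<dots> = (\<Sum>x\<in>{0..<q}. q * Legendre x q * (Legendre x q + Legendre (- x) q))"
  proof (intro sum.cong refl)
    fix x assume x: "x \<in> {0..<q}"
    show "(\<Sum>y\<in>{0..<q}. q * Legendre x q * (if q dvd x^2 - y^2 then Legendre y q else 0) -
        Legendre x q * Legendre y q) = q * Legendre x q * (Legendre x q + Legendre (- x) q)"
      unfolding sum_subtractf sum_distrib_left[symmetric] sum_Legendre sum_equal_squares[OF x] by simp
  qed
  also have "\<dots> = (\<Sum>x\<in>{0..<q}. if q dvd x then 0 else 2 * q)"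
    by (intro sum.cong refl) (simp add: minus Legendre_mult_self Legendre_eq_0_iff mult.assoc flip: mult_2)
  also have "\<dots> = 2 * q * (q - 1)"
    by (simp only: sum_nonzero_residues) simp
  finally show ?thesis .
qed

text \<open>For nonzero \<open>u\<close> the squared sum takes only two values, that of
  \<open>m\<close> on residues and that of \<open>g\<close> on nonresidues. Both classes have the
  same size, so the second moment determines the sum of the two values.\<close>

lemma jacobsthal_sum_of_squares:
  assumes "QuadRes q (- 1)" "QuadRes q m" "\<not> q dvd m"
  shows "(jacobsthal q m)^2 + (jacobsthal q g)^2 = 4 * q"
proof -
  obtain s where s: "[s^2 = m] (mod q)" using assms(2) by (auto simp: QuadRes_def)
  then have "\<not> q dvd s^2" using assms(3) cong_dvd_iff by blast
  then have s0: "\<not> q dvd s" by (auto simp: power2_eq_square)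
  \<comment> \<open>One formula covers both classes; the factor 2 avoids halves, and the term with
    the Legendre symbol disappears on summation over \<open>u\<close>.\<close>
  have *: "2 * (jacobsthal q u)^2 = (if q dvd u then 0 else (jacobsthal q m)^2 + (jacobsthal q g)^2) +
      ((jacobsthal q m)^2 - (jacobsthal q g)^2) * Legendre u q" for u
  proof -
    consider "q dvd u" | "\<not> q dvd u" "QuadRes q u" | "\<not> QuadRes q u" "\<not> q dvd u" by blast
    then show ?thesis
    proof cases
      case 1
      then show ?thesis using Legendre_eq_0_iff jacobsthal_zero by simp
    next
      case 2
      then obtain t where t: "[t^2 = u] (mod q)" by (auto simp: QuadRes_def)
      then have "\<not> q dvd t^2" using 2 cong_dvd_iff by blast
      then have t0: "\<not> q dvd t" by (auto simp: power2_eq_square)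
      have "[s^2 * u = m * t^2] (mod q)" using s t by (intro cong_mult) (simp_all add: cong_sym_eq)
      then have "(jacobsthal q u)^2 = (jacobsthal q m)^2"
        using s0 t0 by (intro jacobsthal_square) (simp_all add: mult.commute)
      moreover have "Legendre u q = 1" using 2 by (simp add: Legendre_def cong_0_iff)
      ultimately show ?thesis using 2 by simp
    next
      case 3
      then have u: "Legendre u q = - 1" by (simp add: Legendre_def cong_0_iff)
      then have "Legendre (u * g) q = 1" by (simp add: Legendre_mult Legendre_nonresidue)
      then have "QuadRes q (u * g)" "\<not> q dvd u * g"
        by (auto simp: Legendre_def cong_0_iff split: if_splits)
      then obtain t where t: "[t^2 = u * g] (mod q)" by (auto simp: QuadRes_def)
      then have "\<not> q dvd t^2" using \<open>\<not> q dvd u * g\<close> cong_dvd_iff by blast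
      then have t0: "\<not> q dvd t" by (auto simp: power2_eq_square)
      have "[g^2 * u = t^2 * g] (mod q)"
        using cong_scalar_right[OF cong_sym[OF t], of g] by (simp add: power2_eq_square ac_simps)
      then have "(jacobsthal q u)^2 = (jacobsthal q g)^2"
        using nonresidue_not_dvd t0 by (intro jacobsthal_square)
      then show ?thesis using 3 u by simp
    qed
  qed
  have "2 * (2 * q * (q - 1)) = (\<Sum>u\<in>{0..<q}. 2 * (jacobsthal q u)^2)"
    by (simp only: sum_jacobsthal_square[OF assms(1)] sum_distrib_left[symmetric])
  also have "\<dots> = (q - 1) * ((jacobsthal q m)^2 + (jacobsthal q g)^2)"
    unfolding * by (simp only: sum.distrib sum_nonzero_residues sum_distrib_left[symmetric] sum_Legendre)
  finally have "(q - 1) * ((jacobsthal q m)^2 + (jacobsthal q g)^2) = (q - 1) * (4 * q)"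
    by (simp only: mult.assoc mult.left_commute mult.commute)
  then show ?thesis using q_gt_2 by simp
qed

end

section \<open>Point counts from Legendre symbols\<close>

lemma card_square_roots:
  "int (card {y \<in> {0..<q}. [y^2 = a] (mod q)}) = 1 + Legendre a q"
proof -
  consider "q dvd a" | "\<not> q dvd a" "QuadRes q a" | "\<not> q dvd a" "\<not> QuadRes q a" by blast
  then show ?thesis
  proof cases
    case 1
    have "[y^2 = a] (mod q) \<longleftrightarrow> q dvd y" for y
      using 1 prime_dvd_power_iff[OF prime_q, of 2 y] by (metis cong_0_iff cong_sym cong_trans zero_less_numeral)
    then have "{y \<in> {0..<q}. [y^2 = a] (mod q)} = {0}"
      using q_gt_2 by (auto simp: dvd_residue_iff)
    then show ?thesis using 1 Legendre_eq_0_iff by simp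
  next
    case 2
    then obtain s where s: "[s^2 = a] (mod q)" by (auto simp: QuadRes_def)
    have s0: "\<not> q dvd s" using s 2 by (metis cong_dvd_iff dvd_mult power2_eq_square)
    have iff: "[y^2 = a] (mod q) \<longleftrightarrow> [y = s] (mod q) \<or> [y = - s] (mod q)" for y
    proof -
      have "[y^2 = a] (mod q) \<longleftrightarrow> [y^2 = s^2] (mod q)" using s by (meson cong_sym cong_trans)
      also have "y^2 - s^2 = (y - s) * (y - - s)" by (simp add: algebra_simps power2_eq_square)
      then have "[y^2 = s^2] (mod q) \<longleftrightarrow> [y = s] (mod q) \<or> [y = - s] (mod q)"
        by (simp add: cong_iff_dvd_diff prime_dvd_mult_iff[OF prime_q] del: diff_minus_eq_add)
      finally show ?thesis .
    qed
    have "{y \<in> {0..<q}. [y^2 = a] (mod q)} = {s mod q, (- s) mod q}"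
      unfolding iff using q_gt_2 by (auto simp: cong_def)
    moreover have "s mod q \<noteq> (- s) mod q"
    proof
      assume "s mod q = (- s) mod q"
      then have "q dvd 2 * s" by (metis cong_def cong_iff_dvd_diff diff_minus_eq_add mult_2)
      then show False using s0 prime_q q_gt_2 by (auto simp: prime_dvd_mult_iff dest: zdvd_imp_le)
    qed
    moreover have "Legendre a q = 1" using 2 by (simp add: Legendre_def cong_0_iff)
    ultimately show ?thesis by simp
  next
    case 3
    then have empty: "{y \<in> {0..<q}. [y^2 = a] (mod q)} = {}" by (auto simp: QuadRes_def)
    have "Legendre a q = - 1" using 3 by (simp add: Legendre_def cong_0_iff)
    then show ?thesis unfolding empty by simp
  qed
qed

lemma card_ec_points: "int (card (ec_points q m)) = q + 1 + jacobsthal q m"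
proof -
  define A where "A = (SIGMA x:{0..<q}. {y \<in> {0..<q}. [y^2 = x^3 - m*x] (mod q)})"
  have fin_roots: "finite {y \<in> {0..<q}. [y^2 = x^3 - m*x] (mod q)}" for x
    by (rule finite_subset[of _ "{0..<q}"]) auto
  then have fin: "finite A" unfolding A_def by (intro finite_SigmaI) auto
  have "ec_points q m = insert Infinity ((\<lambda>(x, y). Affine x y) ` A)"
    by (auto simp: ec_points_def A_def image_iff)
  moreover have "card ((\<lambda>(x, y). Affine x y) ` A) = card A"
    by (intro card_image) (auto simp: inj_on_def)
  moreover have "Infinity \<notin> (\<lambda>(x, y). Affine x y) ` A" by auto
  ultimately have "card (ec_points q m) = Suc (card A)"
    using fin by simp
  also have "int \<dots> = 1 + (\<Sum>x\<in>{0..<q}. int (card {y \<in> {0..<q}. [y^2 = x^3 - m*x] (mod q)}))"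
    unfolding A_def using fin_roots by (subst card_SigmaI) (blast | simp)+
  also have "\<dots> = q + 1 + jacobsthal q m"
    unfolding card_square_roots using q_gt_2 by (simp add: sum.distrib jacobsthal_def)
  finally show ?thesis .
qed

end

section \<open>Polynomial identities on the curve\<close>

text \<open>
  Here \<open>c\<close> is \<open>(1 - i) / 2\<close> modulo \<open>q\<close>. With \<open>t\<close> determined by \<open>x * t = c * y\<close>, the image of
  \<open>(x, y)\<close> under \<open>eta\<close> is \<open>(t ^ 2, t * (x - t ^ 2) - y)\<close>.
\<close>

locale cm_curve =
  fixes q m i c :: int
  assumes prime_q: "prime q" and odd_q: "odd q"
    and i_square: "[i^2 = - 1] (mod q)"
    and two_c: "[2*c = 1 - i] (mod q)"
    and m_nonzero: "\<not> q dvd m"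
begin

lemma q_gt_2: "q > 2"
  using prime_q odd_q prime_ge_2_int[of q] by (cases "q = 2") auto

lemma coprime_q_iff: "coprime a q \<longleftrightarrow> \<not> q dvd a"
  using prime_q by (metis coprime_commute dvd_refl not_coprimeI prime_imp_coprime not_prime_unit)

lemma coprime_2_q: "coprime 2 q"
  using odd_q by simp

lemma inverse_mod_q:
  assumes "\<not> q dvd a"
  obtains b where "[a*b = 1] (mod q)"
  using assms cong_solve_coprime_int coprime_q_iff by metis

lemma dvd_mult_q_iff: "q dvd a * b \<longleftrightarrow> q dvd a \<or> q dvd b"
  using prime_q by (rule prime_dvd_mult_iff)

text \<open>Both (1 + i)/2 and (1 - i)/2 are roots of this quadratic relation. As it does not
  mention \<open>i\<close>, the identities of this section can be stated in \<open>c\<close>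
  alone.\<close>

lemma c_rel: "[2*c^2 = 2*c - 1] (mod q)"
proof -
  have "q dvd 2*c - (1 - i)" "q dvd i^2 - (-1)"
    using two_c i_square by (simp_all add: cong_iff_dvd_diff)
  moreover have "2 * (2*c^2 - (2*c - 1)) = (2*c - (1 + i)) * (2*c - (1 - i)) + (i^2 - (-1))"
    by Groebner_Basis.algebra
  ultimately have "q dvd 2 * (2*c^2 - (2*c - 1))" by (metis dvd_add dvd_mult)
  then show ?thesis
    using coprime_2_q by (metis cong_iff_dvd_diff coprime_commute coprime_dvd_mult_right_iff)
qed

lemma c_inverse:
  shows "[(2 - 2*c)*c = 1] (mod q)"
proof -
  have eq: "(2 - 2*c)*c - 1 = - 1 * (2*c^2 - (2*c - 1))"
    by Groebner_Basis.algebra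
  show ?thesis
    unfolding cong_iff_dvd_diff
    by (subst eq) (intro c_rel[unfolded cong_iff_dvd_diff] dvd_add dvd_mult)
qed

text \<open>In \<open>eta_line2\<close> this turns \<open>4*m\<close> into \<open>- m\<close>, so
  that the image line is met with the same curve and not with a twist of it.\<close>

lemma c_fourth:
  shows "[4*c^4 = - 1] (mod q)"
proof -
  have eq: "4*c^4 - (- 1) = (2*c^2 + 2*c + 1) * (2*c^2 - (2*c - 1))"
    by Groebner_Basis.algebra
  show ?thesis
    unfolding cong_iff_dvd_diff
    by (subst eq) (intro c_rel[unfolded cong_iff_dvd_diff] dvd_add dvd_mult)
qed

text \<open>The difference of the two sides is written as an explicit combination of the differences
  in the hypotheses and in \<open>c_rel\<close>, with \<open>v\<close> as the inverse of
  \<open>x\<close>. Each summand is then a multiple of \<open>q\<close>. Most identities below carry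
  such an ideal membership certificate.\<close>

lemma eta_on_curve:
  assumes "[x*v = 1] (mod q)"
    and "[x*t = c*y] (mod q)"
    and "[y^2 = x^3 - m*x] (mod q)"
  shows "[(t*(x - t^2) - y)^2 = (t^2)^3 - m*t^2] (mod q)"
proof -
  have eq: "(t*(x - t^2) - y)^2 - ((t^2)^3 - m*t^2) = (2*y*t^3*c + 2*y*t*x + t^2*x^2 + m*x -
     2*y*t^3 - 2*y*t*c*x - t^2*m - x^3) * (x*v - 1) + (2*y*t^2*v + 2*y*v*c*x + 2*t*x - 2*y*t^2*v*c
     - 2*y*v*x - 2*t^3) * (x*t - c*y) + (t^2*v + 1 - v*x) * (y^2 - (x^3 - m*x)) + (y^2*v*x -
     y^2*t^2*v) * (2*c^2 - (2*c - 1))"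
    by Groebner_Basis.algebra
  show ?thesis
    unfolding cong_iff_dvd_diff
    by (subst eq) (intro assms[unfolded cong_iff_dvd_diff] c_rel[unfolded cong_iff_dvd_diff] dvd_add dvd_mult)
qed

text \<open>Translation of \<open>(x, y)\<close> by \<open>(0, 0)\<close> gives
  \<open>(X, Y)\<close> with \<open>X = - m / x\<close> and \<open>Y / X = - y / x\<close>. So
  \<open>t\<close> changes sign and \<open>t^2\<close> is unchanged.\<close>

lemma tau_slope:
  assumes "[x*Y = - y*X] (mod q)"
    and "[x*t = c*y] (mod q)"
  shows "[x*(X*(- t)) = x*(c*Y)] (mod q)"
proof -
  have eq: "x*(X*(- t)) - (x*(c*Y)) = - c * (x*Y - (- y*X)) + - X * (x*t - c*y)"
    by Groebner_Basis.algebra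
  show ?thesis
    unfolding cong_iff_dvd_diff
    by (subst eq) (intro assms[unfolded cong_iff_dvd_diff] dvd_add dvd_mult)
qed

lemma tau_eta:
  assumes "[x*v = 1] (mod q)"
    and "[x*t = c*y] (mod q)"
    and "[y^2 = x^3 - m*x] (mod q)"
    and "[x*X = - m] (mod q)"
    and "[x*Y = - y*X] (mod q)"
  shows "[(- t)*(X - (- t)^2) - Y = t*(x - t^2) - y] (mod q)"
proof -
  have eq: "(- t)*(X - (- t)^2) - Y - (t*(x - t^2) - y) = (2*Y*c + t*X + 2*t*v*x^2*c + t*v*m +
     2*t*x*c - 2*Y*c^2 - 2*t^3 - 2*t^2*y*v*c - t*v*x^2 - 2*t*v*m*c - t*x) * (x*v - 1) + (2*t^2*v +
     2*t*y*v^2*c + 2*X*v*c + 2*c - 2*X*v - 2) * (x*t - c*y) + (2*t*v^2*c - t*v^2) * (y^2 - (x^3 -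
     m*x)) + (t*v - 2*t*v*c) * (x*X - (- m)) + (2*v*c^2 - 2*v*c) * (x*Y - (- y*X)) + (t*y^2*v^2 +
     y - Y) * (2*c^2 - (2*c - 1))"
    by Groebner_Basis.algebra
  show ?thesis
    unfolding cong_iff_dvd_diff
    by (subst eq) (intro assms[unfolded cong_iff_dvd_diff] c_rel[unfolded cong_iff_dvd_diff] dvd_add dvd_mult)
qed

lemma tau_on_curve:
  assumes "[x*v = 1] (mod q)"
    and "[y^2 = x^3 - m*x] (mod q)"
    and "[x*X = - m] (mod q)"
    and "[x*Y = - y*X] (mod q)"
  shows "[Y^2 = X^3 - m*X] (mod q)"
proof -
  have eq: "Y^2 - (X^3 - m*X) = (Y*X*y*v + X^3 + X^2*v*x^2 - Y^2 - X^2*v*m - X*m) * (x*v - 1) +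
     (X^2*v^2) * (y^2 - (x^3 - m*x)) + (X*v*x - X^2*v) * (x*X - (- m)) + (Y*v - X*y*v^2) * (x*Y -
     (- y*X))"
    by Groebner_Basis.algebra
  show ?thesis
    unfolding cong_iff_dvd_diff
    by (subst eq) (intro assms[unfolded cong_iff_dvd_diff] dvd_add dvd_mult)
qed

text \<open>By Vieta, the hypotheses say that \<open>x\<close>, \<open>a\<close>, \<open>b\<close>
  are the roots of \<open>X^3 - m*X - (l*X + n)^2\<close>; the combination evaluates this cubic at
  its root \<open>x\<close>.\<close>

lemma line_on_curve:
  assumes "[x + a + b = l^2] (mod q)"
    and "[x*a + x*b + a*b = - m - 2*l*n] (mod q)"
    and "[x*a*b = n^2] (mod q)"
  shows "[(l*x + n)^2 = x^3 - m*x] (mod q)"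
proof -
  have eq: "(l*x + n)^2 - (x^3 - m*x) = - (x^2) * (x + a + b - l^2) + x * (x*a + x*b + a*b - (- m
     - 2*l*n)) + - 1 * (x*a*b - n^2)"
    by Groebner_Basis.algebra
  show ?thesis
    unfolding cong_iff_dvd_diff
    by (subst eq) (intro assms[unfolded cong_iff_dvd_diff] dvd_add dvd_mult)
qed

text \<open>
  A line \<open>y = l * x + n\<close> with \<open>n\<close> invertible meets the curve in three points with nonzero \<open>x\<close>. In
  terms of \<open>M = m / n\<close> and \<open>r = n / x\<close>, the points have \<open>y / x = l + r\<close>, and \<open>eta\<close> takes them to
  points of the line with slope \<open>c * (l + M)\<close> and intercept \<open>c ^ 3 * (n - M * l ^ 2)\<close>.
\<close>

lemma recip_rel:
  assumes "[n*w = 1] (mod q)"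
    and "[m = M*n] (mod q)"
    and "[x*r = n] (mod q)"
    and "[(l*x + n)^2 = x^3 - m*x] (mod q)"
  shows "[x = (l + r)^2 + M*r] (mod q)"
proof -
  have eq: "x - ((l + r)^2 + M*r) = (r^2*w*n + r^2 + 2*r*w*n*l + r*w*l^2*x + r*w*m + 2*r*l + r*M +
     l^2 - r*w*x^2 - x) * (n*w - 1) + (r*w) * (m - M*n) + (2*r*w^2*n*l + r*w^2*l^2*x + r*w^2*m +
     w*l^2 - r*w^2*x^2 - w*x) * (x*r - n) + - (r^2*w^2) * ((l*x + n)^2 - (x^3 - m*x))"
    by Groebner_Basis.algebra
  show ?thesis
    unfolding cong_iff_dvd_diff
    by (subst eq) (intro assms[unfolded cong_iff_dvd_diff] dvd_add dvd_mult)
qed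

lemma eta_line_y:
  assumes "[x*r = n] (mod q)"
    and "[x = (l + r)^2 + M*r] (mod q)"
  shows "[c*(l + r)*(x - (c*(l + r))^2) - (l*x + n) = c*(l + M)*(c*(l + r))^2 + c^3*(n - M*l^2)] (mod q)"
proof -
  have eq: "c*(l + r)*(x - (c*(l + r))^2) - (l*x + n) - (c*(l + M)*(c*(l + r))^2 + c^3*(n -
     M*l^2)) = (c - c^3) * (x*r - n) + (2*l*c^3 + r*c^3) * (x - ((l + r)^2 + M*r)) + - (x*l*c +
     x*l + n*c + n) * (2*c^2 - (2*c - 1))"
    by Groebner_Basis.algebra
  show ?thesis
    unfolding cong_iff_dvd_diff
    by (subst eq) (intro assms[unfolded cong_iff_dvd_diff] c_rel[unfolded cong_iff_dvd_diff] dvd_add dvd_mult)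
qed

text \<open>Reversing the cubic satisfied by the \<open>x\<close> gives
  \<open>r^3 + (M + 2*l)*r^2 + l^2*r - n\<close> for \<open>r = n / x\<close>. This lemma and the
  next two are its Vieta relations.\<close>

lemma recip_sum1:
  assumes "[x1*x2 + x1*x3 + x2*x3 = - m - 2*l*n] (mod q)"
    and "[x1*x2*x3 = n^2] (mod q)"
    and "[x1*r1 = n] (mod q)"
    and "[x2*r2 = n] (mod q)"
    and "[x3*r3 = n] (mod q)"
    and "[n*w = 1] (mod q)"
    and "[m = M*n] (mod q)"
  shows "[r1 + r2 + r3 = - M - 2*l] (mod q)"
proof -
  have eq: "r1 + r2 + r3 - (- M - 2*l) = (w^2*n) * (x1*x2 + x1*x3 + x2*x3 - (- m - 2*l*n)) + -
     (r1*w^2 + r2*w^2 + r3*w^2) * (x1*x2*x3 - n^2) + (x2*x3*w^2) * (x1*r1 - n) + (x1*x3*w^2) *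
     (x2*r2 - n) + (x1*x2*w^2) * (x3*r3 - n) + - (r1*w*n + r1 + r2*w*n + r2 + r3*w*n + r3 +
     2*w*n*l + w*m + M + 2*l) * (n*w - 1) + - w * (m - M*n)"
    by Groebner_Basis.algebra
  show ?thesis
    unfolding cong_iff_dvd_diff
    by (subst eq) (intro assms[unfolded cong_iff_dvd_diff] dvd_add dvd_mult)
qed

lemma recip_sum2:
  assumes "[x1 + x2 + x3 = l^2] (mod q)"
    and "[x1*x2*x3 = n^2] (mod q)"
    and "[x1*r1 = n] (mod q)"
    and "[x2*r2 = n] (mod q)"
    and "[x3*r3 = n] (mod q)"
    and "[n*w = 1] (mod q)"
  shows "[r1*r2 + r1*r3 + r2*r3 = l^2] (mod q)"
proof -
  have eq: "r1*r2 + r1*r3 + r2*r3 - l^2 = 1 * (x1 + x2 + x3 - l^2) + - (r1*r2*w^2 + r1*r3*w^2 +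
     r2*r3*w^2) * (x1*x2*x3 - n^2) + (x2*x3*r2*w^2 + x2*x3*r3*w^2) * (x1*r1 - n) + (x1*x3*r3*w^2 +
     x3*w) * (x2*r2 - n) + (x1*w + x2*w) * (x3*r3 - n) + (x1*x3*r3*w + x1 + x2*x3*r2*w +
     x2*x3*r3*w + x2 + x3 - r1*r2*w*n - r1*r2 - r1*r3*w*n - r1*r3 - r2*r3*w*n - r2*r3) * (n*w -
     1)"
    by Groebner_Basis.algebra
  show ?thesis
    unfolding cong_iff_dvd_diff
    by (subst eq) (intro assms[unfolded cong_iff_dvd_diff] dvd_add dvd_mult)
qed

lemma recip_sum3:
  assumes "[x1*x2*x3 = n^2] (mod q)"
    and "[x1*r1 = n] (mod q)"
    and "[x2*r2 = n] (mod q)"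
    and "[x3*r3 = n] (mod q)"
    and "[n*w = 1] (mod q)"
  shows "[r1*r2*r3 = n] (mod q)"
proof -
  have eq: "r1*r2*r3 - n = - (r1*r2*r3*w^2) * (x1*x2*x3 - n^2) + (x2*x3*r2*r3*w^2) * (x1*r1 - n) +
     (x3*r3*w) * (x2*r2 - n) + 1 * (x3*r3 - n) + (x2*x3*r2*r3*w + x3*r3 - r1*r2*r3*w*n - r1*r2*r3)
     * (n*w - 1)"
    by Groebner_Basis.algebra
  show ?thesis
    unfolding cong_iff_dvd_diff
    by (subst eq) (intro assms[unfolded cong_iff_dvd_diff] dvd_add dvd_mult)
qed

text \<open>Shifting the roots by \<open>l\<close> passes to \<open>s = l + r = y / x\<close>, the
  slope of the line joining the point to \<open>(0, 0)\<close>. Again there are three Vieta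
  relations.\<close>

lemma slope_sum1:
  assumes "[r1 + r2 + r3 = - M - 2*l] (mod q)"
  shows "[(l + r1) + (l + r2) + (l + r3) = l - M] (mod q)"
proof -
  have eq: "(l + r1) + (l + r2) + (l + r3) - (l - M) = 1 * (r1 + r2 + r3 - (- M - 2*l))"
    by Groebner_Basis.algebra
  show ?thesis
    unfolding cong_iff_dvd_diff
    by (subst eq) (intro assms[unfolded cong_iff_dvd_diff] dvd_add dvd_mult)
qed

lemma slope_sum2:
  assumes "[r1 + r2 + r3 = - M - 2*l] (mod q)"
    and "[r1*r2 + r1*r3 + r2*r3 = l^2] (mod q)"
  shows "[(l + r1)*(l + r2) + (l + r1)*(l + r3) + (l + r2)*(l + r3) = - 2*l*M] (mod q)"
proof -
  have eq: "(l + r1)*(l + r2) + (l + r1)*(l + r3) + (l + r2)*(l + r3) - (- 2*l*M) = (2*l) * (r1 +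
     r2 + r3 - (- M - 2*l)) + 1 * (r1*r2 + r1*r3 + r2*r3 - l^2)"
    by Groebner_Basis.algebra
  show ?thesis
    unfolding cong_iff_dvd_diff
    by (subst eq) (intro assms[unfolded cong_iff_dvd_diff] dvd_add dvd_mult)
qed

lemma slope_sum3:
  assumes "[r1 + r2 + r3 = - M - 2*l] (mod q)"
    and "[r1*r2 + r1*r3 + r2*r3 = l^2] (mod q)"
    and "[r1*r2*r3 = n] (mod q)"
  shows "[(l + r1)*(l + r2)*(l + r3) = n - M*l^2] (mod q)"
proof -
  have eq: "(l + r1)*(l + r2)*(l + r3) - (n - M*l^2) = (l^2) * (r1 + r2 + r3 - (- M - 2*l)) + l *
     (r1*r2 + r1*r3 + r2*r3 - l^2) + 1 * (r1*r2*r3 - n)"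
    by Groebner_Basis.algebra
  show ?thesis
    unfolding cong_iff_dvd_diff
    by (subst eq) (intro assms[unfolded cong_iff_dvd_diff] dvd_add dvd_mult)
qed

text \<open>With \<open>k = c\<close>, the images under \<open>eta\<close> have first coordinates
  \<open>(k*s)^2\<close>. This lemma, \<open>eta_line2\<close> and \<open>eta_line3\<close> are the
  Vieta relations of these squares for the image line; here \<open>(l - M)^2 + 4*l*M\<close> is the
  square of \<open>l + M\<close>.\<close>

lemma eta_line1:
  assumes "[s1 + s2 + s3 = l - M] (mod q)"
    and "[s1*s2 + s1*s3 + s2*s3 = - 2*l*M] (mod q)"
  shows "[(k*s1)^2 + (k*s2)^2 + (k*s3)^2 = (k*(l + M))^2] (mod q)"
proof -
  have eq: "(k*s1)^2 + (k*s2)^2 + (k*s3)^2 - ((k*(l + M))^2) = (s1*k^2 + s2*k^2 + s3*k^2 + l*k^2 -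
     M*k^2) * (s1 + s2 + s3 - (l - M)) + - (2*k^2) * (s1*s2 + s1*s3 + s2*s3 - (- 2*l*M))"
    by Groebner_Basis.algebra
  show ?thesis
    unfolding cong_iff_dvd_diff
    by (subst eq) (intro assms[unfolded cong_iff_dvd_diff] dvd_add dvd_mult)
qed

text \<open>This is \<open>e2^2 - 2*e1*e3\<close> in the elementary symmetric functions of the
  slopes, rearranged with \<open>m = M*n\<close> so that the factor \<open>l + M\<close> of the new
  slope appears.\<close>

lemma slope_sum_sq:
  assumes "[s1 + s2 + s3 = l - M] (mod q)"
    and "[s1*s2 + s1*s3 + s2*s3 = - 2*l*M] (mod q)"
    and "[s1*s2*s3 = n - M*l^2] (mod q)"
    and "[m = M*n] (mod q)"
  shows "[s1^2*s2^2 + s1^2*s3^2 + s2^2*s3^2 = 4*m - 2*(l + M)*(n - M*l^2)] (mod q)"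
proof -
  have eq: "s1^2*s2^2 + s1^2*s3^2 + s2^2*s3^2 - (4*m - 2*(l + M)*(n - M*l^2)) = (s1*s2^2 + s1*s3^2
     + s2^2*s3 + s2*s3^2 + 2*s2*M*l + 2*s3*M*l) * (s1 + s2 + s3 - (l - M)) + (s2*l + s3*l - s2^2 -
     s2*s3 - s2*M - s3^2 - s3*M - 2*M*l) * (s1*s2 + s1*s3 + s2*s3 - (- 2*l*M)) + (2*M - 2*l) *
     (s1*s2*s3 - (n - M*l^2)) + - 4 * (m - M*n)"
    by Groebner_Basis.algebra
  show ?thesis
    unfolding cong_iff_dvd_diff
    by (subst eq) (intro assms[unfolded cong_iff_dvd_diff] dvd_add dvd_mult)
qed

lemma eta_line2:
  assumes "[s1^2*s2^2 + s1^2*s3^2 + s2^2*s3^2 = 4*m - 2*(l + M)*(n - M*l^2)] (mod q)"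
    and "[4*k^4 = - 1] (mod q)"
  shows "[(k*s1)^2*(k*s2)^2 + (k*s1)^2*(k*s3)^2 + (k*s2)^2*(k*s3)^2 =
    - m - 2*(k*(l + M))*(k^3*(n - M*l^2))] (mod q)"
proof -
  have eq: "(k*s1)^2*(k*s2)^2 + (k*s1)^2*(k*s3)^2 + (k*s2)^2*(k*s3)^2 -
      (- m - 2*(k*(l + M))*(k^3*(n - M*l^2))) =
    k^4 * (s1^2*s2^2 + s1^2*s3^2 + s2^2*s3^2 - (4*m - 2*(l + M)*(n - M*l^2))) +
    m * (4*k^4 - (- 1))"
    by (simp add: algebra_simps power2_eq_square power3_eq_cube power4_eq_xxxx)
  show ?thesis
    unfolding cong_iff_dvd_diff eq
    by (intro assms[unfolded cong_iff_dvd_diff] dvd_add dvd_mult)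
qed

lemma eta_line3:
  assumes "[s1*s2*s3 = n - M*l^2] (mod q)"
  shows "[(k*s1)^2*(k*s2)^2*(k*s3)^2 = (k^3*(n - M*l^2))^2] (mod q)"
proof -
  have "(k*s1)^2*(k*s2)^2*(k*s3)^2 = (k^3*(s1*s2*s3))^2"
    by (simp add: power2_eq_square power3_eq_cube)
  then show ?thesis
    using assms by (simp add: cong_pow cong_scalar_left)
qed

section \<open>Points with equal images under eta, and secants\<close>

lemma fibre_y:
  assumes "[x*t = c*y] (mod q)"
    and "[X*t = c*Y] (mod q)"
    and "[t*(x - t^2) - y = t*(X - t^2) - Y] (mod q)"
  shows "[y = Y] (mod q)"
proof -
  \<comment> \<open>For given \<open>t\<close>, the second coordinate of the image is
    \<open>(c - 1)*y - t^3\<close>, and \<open>c - 1\<close> has the inverse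
    \<open>- 2*c\<close>.\<close>
  have eq: "y - Y = (2*c) * (x*t - c*y) + - (2*c) * (X*t - c*Y) + - (2*c) * (t*(x - t^2) - y -
     (t*(X - t^2) - Y)) + (y - Y) * (2*c^2 - (2*c - 1))"
    by Groebner_Basis.algebra
  show ?thesis
    unfolding cong_iff_dvd_diff
    by (subst eq) (intro assms[unfolded cong_iff_dvd_diff] c_rel[unfolded cong_iff_dvd_diff] dvd_add dvd_mult)
qed

lemma fibre_tau_x:
  assumes "[t*u = 1] (mod q)"
    and "[x*v = 1] (mod q)"
    and "[y^2 = x^3 - m*x] (mod q)"
    and "[x*t = c*y] (mod q)"
    and "[X*(- t) = c*Y] (mod q)"
    and "[t*(x - t^2) - y = (- t)*(X - (- t)^2) - Y] (mod q)"
  shows "[x*X = - m] (mod q)"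
proof -
  have eq: "x*X - (- m) = (2*y*u*t^2 + 2*y*t + 2*t^2*x - 2*y*u*t^2*c - y*u*x*c - y*u*X*c - 4*y*t*c
     - x^2 - x*X) * (t*u - 1) + (2*y*t*c + x^2 - 2*y*t - m) * (x*v - 1) + v * (y^2 - (x^3 - m*x))
     + (2*y*u^2*c + 2*y*v + u*x + u*X + 2*t - y*u^2 - 2*y*v*c - 2*u*t^2) * (x*t - c*y) + (y*u^2 -
     2*y*u^2*c) * (X*(- t) - c*Y) + (y*u^2 - y*u^2*c) * (t*(x - t^2) - y - ((- t)*(X - (- t)^2) -
     Y)) + (y^2*u^2 - y^2*v - y*Y*u^2) * (2*c^2 - (2*c - 1))"
    by Groebner_Basis.algebra
  show ?thesis
    unfolding cong_iff_dvd_diff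
    by (subst eq) (intro assms[unfolded cong_iff_dvd_diff] c_rel[unfolded cong_iff_dvd_diff] dvd_add dvd_mult)
qed

lemma fibre_tau_y:
  assumes "[t*u = 1] (mod q)"
    and "[x*t = c*y] (mod q)"
    and "[X*(- t) = c*Y] (mod q)"
    and "[t*(x - t^2) - y = (- t)*(X - (- t)^2) - Y] (mod q)"
  shows "[x*Y = - y*X] (mod q)"
proof -
  have eq: "x*Y - (- y*X) = (y*x*c + y*X*c - 2*y*t^2*c - y*x - y*X) * (t*u - 1) + (y*u + 2*t^2 - x
     - X) * (x*t - c*y) + - (y*u) * (X*(- t) - c*Y) + (x - y*u*c) * (t*(x - t^2) - y - ((- t)*(X -
     (- t)^2) - Y))"
    by Groebner_Basis.algebra
  show ?thesis
    unfolding cong_iff_dvd_diff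
    by (subst eq) (intro assms[unfolded cong_iff_dvd_diff] dvd_add dvd_mult)
qed

text \<open>Here \<open>l\<close> is the slope of the secant, with \<open>d\<close> the inverse of
  \<open>x2 - x1\<close>. This lemma and the next two supply the line equation and the Vieta
  relations with third root \<open>l^2 - x1 - x2\<close>.\<close>

lemma secant_y:
  assumes "[d*(x2 - x1) = 1] (mod q)"
    and "[l = d*(y2 - y1)] (mod q)"
  shows "[y2 = l*x2 + (y1 - l*x1)] (mod q)"
proof -
  have eq: "y2 - (l*x2 + (y1 - l*x1)) = (y1 - y2) * (d*(x2 - x1) - 1) + (x1 - x2) * (l - (d*(y2 -
     y1)))"
    by Groebner_Basis.algebra
  show ?thesis
    unfolding cong_iff_dvd_diff
    by (subst eq) (intro assms[unfolded cong_iff_dvd_diff] dvd_add dvd_mult)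
qed

lemma secant_e2:
  assumes "[d*(x2 - x1) = 1] (mod q)"
    and "[y1^2 = x1^3 - m*x1] (mod q)"
    and "[y2^2 = x2^3 - m*x2] (mod q)"
    and "[l = d*(y2 - y1)] (mod q)"
  shows "[x1*x2 + x1*(l^2 - x1 - x2) + x2*(l^2 - x1 - x2) = - m - 2*l*(y1 - l*x1)] (mod q)"
proof -
  have eq: "x1*x2 + x1*(l^2 - x1 - x2) + x2*(l^2 - x1 - x2) - (- m - 2*l*(y1 - l*x1)) = (l*y2 +
     x1^2 + x1*x2 + x2^2 - l*y1 - m) * (d*(x2 - x1) - 1) + - d * (y1^2 - (x1^3 - m*x1)) + d *
     (y2^2 - (x2^3 - m*x2)) + (l*x2 + y1 + y2 - l*x1) * (l - (d*(y2 - y1)))"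
    by Groebner_Basis.algebra
  show ?thesis
    unfolding cong_iff_dvd_diff
    by (subst eq) (intro assms[unfolded cong_iff_dvd_diff] dvd_add dvd_mult)
qed

lemma secant_e3:
  assumes "[d*(x2 - x1) = 1] (mod q)"
    and "[y1^2 = x1^3 - m*x1] (mod q)"
    and "[y2^2 = x2^3 - m*x2] (mod q)"
    and "[l = d*(y2 - y1)] (mod q)"
  shows "[x1*x2*(l^2 - x1 - x2) = (y1 - l*x1)^2] (mod q)"
proof -
  have eq: "x1*x2*(l^2 - x1 - x2) - ((y1 - l*x1)^2) = (l*y2*x1 + y1^2 + x1^2*x2 + x1*x2^2 + x2^3 -
     l*y1*x1 - y2^2 - x2*m) * (d*(x2 - x1) - 1) + - (d*x2) * (y1^2 - (x1^3 - m*x1)) + (d*x2 - 1) *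
     (y2^2 - (x2^3 - m*x2)) + (l*x1*x2 + y1*x1 + y2*x1 - l*x1^2) * (l - (d*(y2 - y1)))"
    by Groebner_Basis.algebra
  show ?thesis
    unfolding cong_iff_dvd_diff
    by (subst eq) (intro assms[unfolded cong_iff_dvd_diff] dvd_add dvd_mult)
qed

section \<open>Translation by (0, 0) and the fibres of eta\<close>

text \<open>Arbitrary integers may serve as coordinates, and equality of points becomes congruence
  (\<open>pt_eq_iff\<close>).\<close>

definition pt :: "int \<Rightarrow> int \<Rightarrow> point" where
  "pt x y = Affine (x mod q) (y mod q)"

abbreviation G :: "point set" where
  "G \<equiv> ec_points q m"

abbreviation T :: point where
  "T \<equiv> pt 0 0"

abbreviation on_curve :: "int \<Rightarrow> int \<Rightarrow> bool" where
  "on_curve x y \<equiv> [y^2 = x^3 - m*x] (mod q)"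

text \<open>On the points of the curve \<open>eta\<close> never fails modulo the prime
  \<open>q\<close> (\<open>eta_eq_etaq\<close>), so \<open>the\<close> loses nothing there.\<close>

definition etaq :: "point \<Rightarrow> point" where
  "etaq P = the (eta q m i P)"

fun neg :: "point \<Rightarrow> point" where
  "neg Infinity = Infinity"
| "neg (Affine x y) = Affine x (- y mod q)"

text \<open>Addition of \<open>T\<close>: the line through \<open>(x, y)\<close> and
  \<open>(0, 0)\<close> meets the curve again where the first coordinate is \<open>- m / x\<close>.
  On the curve, \<open>q dvd x\<close> singles out \<open>T\<close> itself.\<close>

definition tau :: "point \<Rightarrow> point" where
  "tau P = (case P of Infinity \<Rightarrow> T
     | Affine x y \<Rightarrow> if q dvd x then Infinity
         else pt (- m * modular_inverse q x) (m * y * modular_inverse q x ^ 2))"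

lemma pt_eq_iff: "pt x y = pt x' y' \<longleftrightarrow> [x = x'] (mod q) \<and> [y = y'] (mod q)"
  by (simp add: pt_def cong_def)

lemma pt_neq_Infinity [simp]: "pt x y \<noteq> Infinity" "Infinity \<noteq> pt x y"
  by (simp_all add: pt_def)

lemma T_eq: "T = Affine 0 0"
  by (simp add: pt_def)

lemma on_curve_cong:
  assumes "[x = x'] (mod q)" "[y = y'] (mod q)"
  shows "on_curve x y \<longleftrightarrow> on_curve x' y'"
proof -
  have "[y^2 = y'^2] (mod q)" "[x^3 - m*x = x'^3 - m*x'] (mod q)"
    by (auto intro!: cong_pow cong_diff cong_mult assms)
  then show ?thesis by (meson cong_sym cong_trans)
qed

lemma pt_in_G: "pt x y \<in> G \<longleftrightarrow> on_curve x y"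
proof -
  have "pt x y \<in> G \<longleftrightarrow> on_curve (x mod q) (y mod q)"
    using q_gt_2 by (auto simp: pt_def ec_points_def)
  also have "\<dots> \<longleftrightarrow> on_curve x y"
    by (intro on_curve_cong) simp_all
  finally show ?thesis .
qed

lemma Infinity_in_G [simp]: "Infinity \<in> G"
  by (simp add: ec_points_def)

lemma T_in_G [simp]: "T \<in> G"
  by (simp add: pt_in_G)

lemma Affine_eq_pt: "Affine x y \<in> G \<Longrightarrow> Affine x y = pt x y"
  by (auto simp: ec_points_def pt_def)

lemma pt_eq_T: "on_curve x y \<Longrightarrow> q dvd x \<Longrightarrow> pt x y = T"
proof -
  assume "on_curve x y" "q dvd x"
  then have "[y^2 = 0] (mod q)"
    by (metis cong_0_iff dvd_diff dvd_mult dvd_power_same dvd_trans cong_dvd_iff dvd_power zero_less_numeral)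
  then have "q dvd y" using prime_q by (simp add: cong_0_iff prime_dvd_power_iff)
  with \<open>q dvd x\<close> show ?thesis by (simp add: pt_eq_iff cong_0_iff)
qed

lemma G_cases [consumes 1, case_names Infinity T pt]:
  assumes "P \<in> G"
  obtains "P = Infinity" | "P = T"
    | x y where "P = pt x y" "\<not> q dvd x" "on_curve x y"
proof (cases P)
  case (Affine x y)
  then have "P = pt x y" using assms Affine_eq_pt by blast
  moreover from this have "on_curve x y" using assms pt_in_G by simp
  ultimately show thesis using that pt_eq_T by metis
qed (use that in blast)

lemma eta_Infinity: "eta q m i Infinity = Some Infinity"
  by (simp add: eta_def)

lemma eta_T: "eta q m i T = Some Infinity"
  by (simp add: eta_def pt_def)

lemma eta_pt:
  assumes "\<not> q dvd x" "[x*t = c*y] (mod q)"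
  shows "eta q m i (pt x y) = Some (pt (t^2) (t*(x - t^2) - y))"
proof -
  define x' y' where "x' = x mod q" and "y' = y mod q"
  define l where "l = (1 - i) * y' * modular_inverse q (2 * x')"
  have xy: "[x' = x] (mod q)" "[y' = y] (mod q)" by (simp_all add: x'_def y'_def)
  have "\<not> q dvd 2 * x'"
    using assms(1) coprime_2_q by (simp add: dvd_mult_q_iff coprime_q_iff x'_def dvd_mod_iff)
  then have cop: "coprime (2 * x') q" by (simp add: coprime_q_iff)
  have "[modular_inverse q (2 * x') * (2 * x') = 1] (mod q)"
    by (rule cong_modular_inverse2[OF cop])
  then have "[(1 - i) * y' * (modular_inverse q (2 * x') * (2 * x')) = (1 - i) * y' * 1] (mod q)"
    by (rule cong_scalar_left)
  then have "[l * (2 * x') = (1 - i) * y'] (mod q)"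
    by (simp add: l_def mult.assoc)
  also have "[(1 - i) * y' = 2 * c * y] (mod q)"
    by (intro cong_mult cong_sym[OF two_c] xy)
  also have "[2 * c * y = 2 * (x * t)] (mod q)"
    using cong_scalar_left[OF cong_sym[OF assms(2)], of 2] by (simp add: mult.assoc)
  also have "[2 * (x * t) = 2 * (x' * t)] (mod q)"
    by (intro cong_mult cong_sym[OF xy(1)] cong_refl)
  finally have "[l * (2 * x') = t * (2 * x')] (mod q)" by (simp add: ac_simps)
  then have l: "[l = t] (mod q)" using cop by (simp only: cong_mult_rcancel)
  have "eta q m i (Affine x' y') = Some (pt (l^2) (l * (x' - l^2) - y'))"
    unfolding pt_def l_def using q_gt_2 by (intro eta_Affine i_square cop) auto
  also have "Affine x' y' = pt x y" by (simp add: pt_def x'_def y'_def)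
  also have "pt (l^2) (l * (x' - l^2) - y') = pt (t^2) (t*(x - t^2) - y)"
    unfolding pt_eq_iff by (intro conjI cong_diff cong_mult cong_pow l xy)
  finally show ?thesis .
qed

lemma etaq_simps:
  "etaq Infinity = Infinity" "etaq T = Infinity"
  "\<not> q dvd x \<Longrightarrow> [x*t = c*y] (mod q) \<Longrightarrow> etaq (pt x y) = pt (t^2) (t*(x - t^2) - y)"
  by (simp_all add: etaq_def eta_pt eta_Infinity eta_T)

lemma slope_exists:
  assumes "\<not> q dvd x"
  obtains t where "[x*t = c*y] (mod q)"
proof -
  obtain v where "[x*v = 1] (mod q)" using inverse_mod_q[OF assms] .
  then have "[x*v*(c*y) = 1*(c*y)] (mod q)" by (rule cong_scalar_right)
  then show thesis using that[of "v*(c*y)"] by (simp add: mult.assoc)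
qed

lemma eta_eq_etaq: "P \<in> G \<Longrightarrow> eta q m i P = Some (etaq P)"
  by (cases P rule: G_cases; (simp add: eta_Infinity eta_T etaq_simps)?)
    (metis slope_exists eta_pt etaq_simps(3))

lemma etaq_in_G:
  assumes "P \<in> G"
  shows "etaq P \<in> G"
  using assms
proof (cases P rule: G_cases)
  case (pt x y)
  obtain t where t: "[x*t = c*y] (mod q)" using slope_exists pt(2) .
  obtain v where v: "[x*v = 1] (mod q)" using inverse_mod_q pt(2) .
  show ?thesis
    using eta_on_curve[OF v t pt(3)] by (simp add: pt(1) etaq_simps(3)[OF pt(2) t] pt_in_G)
qed (simp_all add: etaq_simps)

lemma neg_pt: "neg (pt x y) = pt x (- y)"
  by (simp add: pt_def mod_minus_eq)

lemma neg_in_G: "P \<in> G \<Longrightarrow> neg P \<in> G"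
  by (cases P rule: G_cases) (auto simp: neg_pt pt_in_G)

lemma neg_neg: "P \<in> G \<Longrightarrow> neg (neg P) = P"
  by (cases P rule: G_cases) (auto simp: neg_pt)

lemma etaq_neg:
  assumes "P \<in> G"
  shows "etaq (neg P) = neg (etaq P)"
  using assms
proof (cases P rule: G_cases)
  case (pt x y)
  obtain t where t: "[x*t = c*y] (mod q)" using slope_exists pt(2) .
  have "[- (x*t) = - (c*y)] (mod q)" using t by (simp add: cong_minus_minus_iff)
  then have "[x*(-t) = c*(-y)] (mod q)" by simp
  from etaq_simps(3)[OF pt(2) this] etaq_simps(3)[OF pt(2) t] show ?thesis
    by (simp add: pt(1) neg_pt algebra_simps)
qed (simp_all add: etaq_simps neg_pt)

lemma tau_Infinity: "tau Infinity = T"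
  by (simp add: tau_def)

lemma tau_T: "tau T = Infinity"
  by (simp add: tau_def pt_def)

lemma mod_q_mult_cancel: "\<not> q dvd x \<Longrightarrow> [x*a = x*b] (mod q) \<longleftrightarrow> [a = b] (mod q)"
  by (intro cong_mult_lcancel) (simp add: coprime_q_iff)

lemma tau_pt_exists:
  assumes "\<not> q dvd x"
  obtains X Y where "tau (pt x y) = pt X Y" "[x*X = - m] (mod q)" "[x*Y = - y*X] (mod q)"
proof -
  define v where "v = modular_inverse q (x mod q)"
  have "coprime (x mod q) q" using assms by (simp add: coprime_q_iff dvd_mod_iff)
  then have "[v * (x mod q) = 1] (mod q)" unfolding v_def by (rule cong_modular_inverse2)
  moreover have "[v * (x mod q) = v * x] (mod q)" by (simp add: cong_scalar_left)
  ultimately have v: "[x * v = 1] (mod q)" by (metis cong_sym cong_trans mult.commute)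
  have "tau (pt x y) = pt (- m * v) (m * (y mod q) * v^2)"
    using assms by (simp add: tau_def pt_def v_def dvd_mod_iff)
  also have "\<dots> = pt (- m * v) (m * y * v^2)"
    by (auto simp: pt_eq_iff intro!: cong_mult cong_refl)
  finally have 1: "tau (pt x y) = pt (- m * v) (m * y * v^2)" .
  have 2: "[x * (- m * v) = - m] (mod q)"
    using cong_scalar_left[OF v, of "- m"] by (simp add: ac_simps)
  have 3: "[x * (m * y * v^2) = - y * (- m * v)] (mod q)"
    using cong_scalar_left[OF v, of "m * y * v"] by (simp add: ac_simps power2_eq_square)
  from that[OF 1 2 3] show thesis .
qed

lemma tau_pt:
  assumes "\<not> q dvd x" "[x*X = - m] (mod q)" "[x*Y = - y*X] (mod q)"
  shows "tau (pt x y) = pt X Y"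
proof -
  obtain X' Y' where XY: "tau (pt x y) = pt X' Y'" "[x*X' = - m] (mod q)" "[x*Y' = - y*X'] (mod q)"
    using tau_pt_exists[OF assms(1)] .
  have X: "[X' = X] (mod q)"
    using assms(2) XY(2) mod_q_mult_cancel[OF assms(1)] by (meson cong_sym cong_trans)
  have "[- y*X' = - y*X] (mod q)" using X by (rule cong_scalar_left)
  then have "[Y' = Y] (mod q)"
    using assms(3) XY(3) mod_q_mult_cancel[OF assms(1)] by (meson cong_sym cong_trans)
  with X XY(1) show ?thesis by (simp add: pt_eq_iff)
qed

lemma tau_pt_nonzero: "[x*X = - m] (mod q) \<Longrightarrow> \<not> q dvd X"
  using m_nonzero by (metis cong_dvd_iff dvd_minus_iff dvd_mult)

lemma tau_in_G:
  assumes "P \<in> G"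
  shows "tau P \<in> G"
  using assms
proof (cases P rule: G_cases)
  case (pt x y)
  obtain X Y where "tau (pt x y) = pt X Y" "[x*X = - m] (mod q)" "[x*Y = - y*X] (mod q)"
    using tau_pt_exists pt(2) .
  moreover obtain v where "[x*v = 1] (mod q)" using inverse_mod_q pt(2) .
  ultimately show ?thesis using tau_on_curve pt by (simp add: pt_in_G)
qed (simp_all add: tau_Infinity tau_T)

lemma etaq_tau:
  assumes "P \<in> G"
  shows "etaq (tau P) = etaq P"
  using assms
proof (cases P rule: G_cases)
  case (pt x y)
  obtain X Y where XY: "tau (pt x y) = pt X Y" "[x*X = - m] (mod q)" "[x*Y = - y*X] (mod q)"
    using tau_pt_exists pt(2) .
  obtain t where t: "[x*t = c*y] (mod q)" using slope_exists pt(2) .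
  obtain v where v: "[x*v = 1] (mod q)" using inverse_mod_q pt(2) .
  have t': "[X*(- t) = c*Y] (mod q)"
    using tau_slope[OF XY(3) t] mod_q_mult_cancel pt(2) by blast
  have "etaq (tau P) = pt ((- t)^2) ((- t)*(X - (- t)^2) - Y)"
    unfolding pt(1) XY(1) using tau_pt_nonzero[OF XY(2)] t' by (rule etaq_simps(3))
  also have "\<dots> = pt (t^2) (t*(x - t^2) - y)"
    unfolding pt_eq_iff using tau_eta[OF v t pt(3) XY(2,3)] by simp
  also have "\<dots> = etaq P"
    unfolding pt(1) using etaq_simps(3)[OF pt(2) t] by simp
  finally show ?thesis .
qed (simp_all add: tau_Infinity tau_T etaq_simps)

lemma cong_square_iff: "[a^2 = b^2] (mod q) \<longleftrightarrow> [a = b] (mod q) \<or> [a = - b] (mod q)"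
proof -
  have "a^2 - b^2 = (a - b) * (a - - b)" by (simp add: algebra_simps power2_eq_square)
  then show ?thesis by (simp add: cong_iff_dvd_diff dvd_mult_q_iff del: diff_minus_eq_add)
qed

lemma on_curve_zero_y:
  assumes "on_curve x y" "\<not> q dvd x" "q dvd y"
  shows "[x^2 = m] (mod q)"
proof -
  have "q dvd y^2 - (x^3 - m*x)" using assms(1) by (simp add: cong_iff_dvd_diff)
  moreover have "q dvd y^2" using assms(3) by (simp add: power2_eq_square)
  ultimately have "q dvd x^3 - m*x" by (metis cong_dvd_iff cong_iff_dvd_diff)
  also have "x^3 - m*x = x * (x^2 - m)"
    by (simp add: algebra_simps power2_eq_square power3_eq_cube)
  finally show ?thesis using assms(2) by (simp add: dvd_mult_q_iff cong_iff_dvd_diff)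
qed

lemma not_dvd_c: "\<not> q dvd c"
proof
  assume "q dvd c"
  then have "q dvd (2 - 2*c)*c" by simp
  then have "q dvd 1" using c_inverse cong_dvd_iff by blast
  then show False using q_gt_2 by simp
qed

lemma cong_self_minus: "[y = - y] (mod q) \<longleftrightarrow> q dvd y"
proof -
  have "[y = - y] (mod q) \<longleftrightarrow> q dvd 2 * y" by (simp add: cong_iff_dvd_diff)
  then show ?thesis using coprime_2_q by (simp add: dvd_mult_q_iff coprime_q_iff)
qed

text \<open>Equal images have equal \<open>t^2\<close>. Opposite nonzero values of \<open>t\<close>
  mean translates by \<open>T\<close>; equal values give equal \<open>y\<close> and, unless
  \<open>y = 0\<close>, equal points.\<close>

lemma etaq_fibre:
  assumes "P \<in> G" "P' \<in> G" "etaq P' = etaq P"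
  shows "P' = P \<or> P' = tau P"
proof -
  have Inf: "R = Infinity \<or> R = T" if R: "R \<in> G" "etaq R = Infinity" for R
    using R(1)
  proof (cases R rule: G_cases)
    case (pt x y)
    then show ?thesis using R(2) slope_exists etaq_simps(3) pt_neq_Infinity by metis
  qed auto
  show ?thesis
    using assms(1)
  proof (cases P rule: G_cases)
    case Infinity
    then show ?thesis using Inf[of P'] assms by (auto simp: etaq_simps tau_Infinity)
  next
    case T
    then show ?thesis using Inf[of P'] assms by (auto simp: etaq_simps tau_T)
  next
    case P: (pt x y)
    obtain t where t: "[x*t = c*y] (mod q)" using slope_exists P(2) .
    note eP = etaq_simps(3)[OF P(2) t]
    show ?thesis
      using assms(2)
    proof (cases P' rule: G_cases)
      case P': (pt X Y)
      obtain t' where t': "[X*t' = c*Y] (mod q)" using slope_exists P'(2) .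
      obtain v where v: "[x*v = 1] (mod q)" using inverse_mod_q P(2) .
      have "[t'^2 = t^2] (mod q)"
        using assms(3) unfolding P(1) P'(1) eP etaq_simps(3)[OF P'(2) t'] pt_eq_iff by simp
      then consider "[t' = t] (mod q)" | "[t' = - t] (mod q)" "\<not> q dvd t"
        unfolding cong_square_iff by (metis cong_sym cong_trans cong_self_minus)
      then show ?thesis
      proof cases
        case 1
        have T: "[X*t = c*Y] (mod q)"
          using cong_scalar_left[OF 1, of X] t' by (meson cong_sym cong_trans)
        have h: "[t*(x - t^2) - y = t*(X - t^2) - Y] (mod q)"
          using assms(3) unfolding P(1) P'(1) eP etaq_simps(3)[OF P'(2) T] pt_eq_iff
          by (simp add: cong_sym_eq)
        have yY: "[y = Y] (mod q)" using fibre_y[OF t T h] .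
        show ?thesis
        proof (cases "q dvd y")
          case False
          then have "\<not> q dvd t"
            using t not_dvd_c by (metis cong_dvd_iff dvd_mult dvd_mult_q_iff)
          moreover have "[x*t = X*t] (mod q)"
            using t T yY by (meson cong_scalar_left cong_sym cong_trans)
          ultimately have "[x = X] (mod q)"
            by (simp add: mod_q_mult_cancel mult.commute[of _ t])
          then show ?thesis using yY P(1) P'(1) by (simp add: pt_eq_iff cong_sym_eq)
        next
          \<comment> \<open>Both points are now of the form \<open>(x, 0)\<close> with
            \<open>x^2 = m\<close>; if they differ, their first coordinates have product
            \<open>- m\<close>, so \<open>tau\<close> exchanges them.\<close>
          case True
          then have "q dvd Y" using yY cong_dvd_iff by blast
          then have XX: "[X^2 = m] (mod q)" using on_curve_zero_y P' by blast
          have "[x^2 = m] (mod q)" using on_curve_zero_y P True by blast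
          then have "[x^2 = X^2] (mod q)" using XX by (meson cong_sym cong_trans)
          then consider "[x = X] (mod q)" | "[x = - X] (mod q)" unfolding cong_square_iff by blast
          then show ?thesis
          proof cases
            case 1
            then show ?thesis using yY P(1) P'(1) by (simp add: pt_eq_iff cong_sym_eq)
          next
            case 2
            have "[x*X = - (X^2)] (mod q)"
              using cong_scalar_right[OF 2, of X] by (simp add: power2_eq_square)
            then have "[x*X = - m] (mod q)"
              using XX by (meson cong_minus_minus_iff cong_trans)
            moreover have "[x*Y = - y*X] (mod q)"
              using True \<open>q dvd Y\<close> by (simp add: cong_iff_dvd_diff)
            ultimately show ?thesis using tau_pt P P'(1) by metis
          qed
        qed
      next
        case 2
        have T: "[X*(- t) = c*Y] (mod q)"
          using cong_scalar_left[OF 2(1), of X] t' by (meson cong_sym cong_trans)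
        have h: "[t*(x - t^2) - y = (- t)*(X - (- t)^2) - Y] (mod q)"
          using assms(3) unfolding P(1) P'(1) eP etaq_simps(3)[OF P'(2) T] pt_eq_iff
          by (simp add: cong_sym_eq)
        obtain u where u: "[t*u = 1] (mod q)" using inverse_mod_q 2(2) .
        have "tau P = P'"
          unfolding P(1) P'(1)
          using P(2) fibre_tau_x[OF u v P(3) t T h] fibre_tau_y[OF u t T h] by (rule tau_pt)
        then show ?thesis by simp
      qed
    qed (use assms(3) eP in \<open>auto simp: P(1) etaq_simps\<close>)
  qed
qed

text \<open>A fixed point with nonzero \<open>x\<close> would have \<open>y = - y\<close>, hence
  \<open>y = 0\<close> and \<open>x^2 = m\<close>, whereas \<open>X = x\<close> gives
  \<open>x^2 = - m\<close>.\<close>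

lemma tau_neq:
  assumes "P \<in> G"
  shows "tau P \<noteq> P"
  using assms
proof (cases P rule: G_cases)
  case (pt x y)
  obtain X Y where XY: "tau (pt x y) = pt X Y" "[x*X = - m] (mod q)" "[x*Y = - y*X] (mod q)"
    using tau_pt_exists pt(2) .
  show ?thesis
  proof
    assume "tau P = P"
    then have X: "[X = x] (mod q)" and Y: "[Y = y] (mod q)"
      using XY(1) pt(1) by (simp_all add: pt_eq_iff)
    have "[x*y = x*Y] (mod q)" using cong_sym[OF Y] by (rule cong_scalar_left)
    also note XY(3)
    also have "[- y*X = - y*x] (mod q)" using X by (rule cong_scalar_left)
    also have "- y*x = x*(- y)" by simp
    finally have "[x*y = x*(- y)] (mod q)" .
    then have "q dvd y" using pt(2) mod_q_mult_cancel cong_self_minus by blast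
    then have "[x^2 = m] (mod q)" using on_curve_zero_y pt by blast
    moreover have "[x*x = x*X] (mod q)" using cong_sym[OF X] by (rule cong_scalar_left)
    then have "[x^2 = - m] (mod q)"
      using XY(2) unfolding power2_eq_square by (rule cong_trans)
    ultimately have "[m = - m] (mod q)" by (meson cong_sym cong_trans)
    then show False using m_nonzero by (simp add: cong_self_minus)
  qed
qed (simp_all add: tau_Infinity tau_T)

text \<open>A point with \<open>y = 0\<close> and nonzero \<open>x\<close> has \<open>t = 0\<close>,
  so \<open>eta\<close> sends it to \<open>T\<close>.\<close>

lemma neg_fixed:
  assumes "P \<in> G" "neg P = P"
  shows "P = Infinity \<or> P = T \<or> etaq P = T"
  using assms(1)
proof (cases P rule: G_cases)
  case (pt x y)
  then have "q dvd y"
    using assms(2) by (simp add: neg_pt pt_eq_iff cong_sym_eq cong_self_minus)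
  then have "[x*0 = c*y] (mod q)" by (simp add: cong_iff_dvd_diff)
  from etaq_simps(3)[OF pt(2) this] \<open>q dvd y\<close> show ?thesis
    by (simp add: pt(1) pt_eq_iff cong_0_iff)
qed simp_all

section \<open>Collinear triples\<close>

text \<open>
  In the last rule, \<open>x1\<close>, \<open>x2\<close>, \<open>x3\<close> are the roots of \<open>X ^ 3 - m * X - (l * X + n) ^ 2\<close>, so that
  intersections are counted with multiplicity and tangents need no separate treatment.
\<close>

inductive coll :: "point \<Rightarrow> point \<Rightarrow> point \<Rightarrow> bool" where
  coll_Inf1: "P \<in> G \<Longrightarrow> coll Infinity P (neg P)"
| coll_Inf2: "P \<in> G \<Longrightarrow> coll P Infinity (neg P)"
| coll_Inf3: "P \<in> G \<Longrightarrow> coll P (neg P) Infinity"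
| coll_line: "\<lbrakk>[x1 + x2 + x3 = l^2] (mod q); [x1*x2 + x1*x3 + x2*x3 = - m - 2*l*n] (mod q);
    [x1*x2*x3 = n^2] (mod q)\<rbrakk>
    \<Longrightarrow> coll (pt x1 (l*x1 + n)) (pt x2 (l*x2 + n)) (pt x3 (l*x3 + n))"

text \<open>If one root and the intercept vanish, the other two roots have product
  \<open>- m\<close>: the third point on the line through \<open>P\<close> and \<open>T\<close> is
  the negative of \<open>tau P\<close>.\<close>

lemma line_through_T:
  assumes "[x*X + x*z + X*z = - m - 2*l*n] (mod q)" "q dvd z" "q dvd n"
  shows "pt X (l*X + n) = neg (tau (pt x (l*x + n)))" "pt z (l*z + n) = T"
proof -
  have "q dvd x*X + x*z + X*z - (- m - 2*l*n)"
    using assms(1) by (simp add: cong_iff_dvd_diff)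
  moreover have "q dvd x*z + X*z + 2*l*n" using assms(2,3) by simp
  ultimately have "q dvd (x*X + x*z + X*z - (- m - 2*l*n)) - (x*z + X*z + 2*l*n)"
    by (rule dvd_diff)
  then have xX: "[x*X = - m] (mod q)" by (simp add: cong_iff_dvd_diff algebra_simps)
  then have "\<not> q dvd x" by (metis mult.commute tau_pt_nonzero)
  moreover have "[x*(- (l*X)) = - (l*x + n)*X] (mod q)"
    using assms(3) by (simp add: cong_iff_dvd_diff algebra_simps)
  ultimately have "tau (pt x (l*x + n)) = pt X (- (l*X))" using xX by (intro tau_pt)
  then show "pt X (l*X + n) = neg (tau (pt x (l*x + n)))"
    using assms(3) by (simp add: neg_pt pt_eq_iff cong_iff_dvd_diff)
  show "pt z (l*z + n) = T" using assms(2,3) by (simp add: pt_eq_iff cong_0_iff)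
qed

lemma coll_in_G:
  assumes "coll P Q R"
  shows "P \<in> G \<and> Q \<in> G \<and> R \<in> G"
  using assms
proof (induction rule: coll.induct)
  case (coll_line x1 x2 x3 l n)
  have 2: "[x2 + x1 + x3 = l^2] (mod q)" "[x2*x1 + x2*x3 + x1*x3 = - m - 2*l*n] (mod q)"
    "[x2*x1*x3 = n^2] (mod q)"
    using coll_line by (simp_all add: ac_simps)
  have 3: "[x3 + x1 + x2 = l^2] (mod q)" "[x3*x1 + x3*x2 + x1*x2 = - m - 2*l*n] (mod q)"
    "[x3*x1*x2 = n^2] (mod q)"
    using coll_line by (simp_all add: ac_simps)
  show ?case
    using line_on_curve[OF coll_line] line_on_curve[OF 2] line_on_curve[OF 3] by (simp add: pt_in_G)
qed (auto intro: neg_in_G)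

lemma etaq_line_point:
  assumes "\<not> q dvd x" "on_curve x (l*x + n)"
    and "[n*w = 1] (mod q)" "[m = M*n] (mod q)" "[x*r = n] (mod q)"
  shows "etaq (pt x (l*x + n)) =
    pt ((c*(l + r))^2) (c*(l + M)*(c*(l + r))^2 + c^3*(n - M*l^2))"
proof -
  have "[x*r + l*x = n + l*x] (mod q)" using assms(5) by (simp add: cong_add_rcancel)
  from cong_scalar_left[OF this, of c] have "[x*(c*(l + r)) = c*(l*x + n)] (mod q)"
    by (simp add: algebra_simps)
  from etaq_simps(3)[OF assms(1) this] eta_line_y[OF assms(5) recip_rel[OF assms(3,4,5,2)]]
  show ?thesis by (simp add: pt_eq_iff)
qed

text \<open>Lines missing \<open>T\<close> are settled by the Vieta relations of the slopes. A line
  through \<open>T\<close> contains \<open>T\<close>, \<open>P\<close> and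
  \<open>neg (tau P)\<close>, whose images are \<open>Infinity\<close>, \<open>etaq P\<close> and
  its negative.\<close>

lemma coll_etaq:
  assumes "coll P Q R"
  shows "coll (etaq P) (etaq Q) (etaq R)"
  using assms
proof cases
  case (coll_line x1 x2 x3 l n)
  note e = coll_line(4-6)
  have on: "on_curve x1 (l*x1 + n)" "on_curve x2 (l*x2 + n)" "on_curve x3 (l*x3 + n)"
    using coll_in_G[OF assms] by (simp_all add: coll_line(1-3) pt_in_G)
  show ?thesis
  proof (cases "q dvd n")
    case True
    \<comment> \<open>The product of the three roots is \<open>n^2\<close>, so a vanishing intercept
      forces one of the points to be \<open>T\<close>.\<close>
    then have "q dvd x1*x2*x3"
      using cong_dvd_iff[OF e(3)] by (simp add: power2_eq_square)
    then consider "q dvd x1" | "q dvd x2" | "q dvd x3" by (auto simp: dvd_mult_q_iff)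
    then show ?thesis
    proof cases
      case 1
      have "[x2*x3 + x2*x1 + x3*x1 = - m - 2*l*n] (mod q)" using e(2) by (simp add: ac_simps)
      from line_through_T[OF this 1 True] coll_in_G[OF assms] show ?thesis
        by (simp add: coll_line(1-3) etaq_simps etaq_neg etaq_tau tau_in_G coll_Inf1 etaq_in_G)
    next
      case 2
      have "[x1*x3 + x1*x2 + x3*x2 = - m - 2*l*n] (mod q)" using e(2) by (simp add: ac_simps)
      from line_through_T[OF this 2 True] coll_in_G[OF assms] show ?thesis
        by (simp add: coll_line(1-3) etaq_simps etaq_neg etaq_tau tau_in_G coll_Inf2 etaq_in_G)
    next
      case 3
      from line_through_T[OF e(2) this True] coll_in_G[OF assms] show ?thesis
        by (simp add: coll_line(1-3) etaq_simps etaq_neg etaq_tau tau_in_G coll_Inf3 etaq_in_G)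
    qed
  next
    case False
    then have nz: "\<not> q dvd x1" "\<not> q dvd x2" "\<not> q dvd x3"
      using cong_dvd_iff[OF e(3)] by (auto simp: power2_eq_square dvd_mult_q_iff)
    obtain w where w: "[n*w = 1] (mod q)" using inverse_mod_q False .
    have M: "[m = m*w*n] (mod q)"
      using cong_scalar_left[OF cong_sym[OF w], of m] by (simp add: ac_simps)
    have div: "\<exists>r. [x*r = n] (mod q)" if "\<not> q dvd x" for x
    proof -
      obtain v where "[x*v = 1] (mod q)" using inverse_mod_q \<open>\<not> q dvd x\<close> .
      from cong_scalar_right[OF this, of n] show ?thesis by (auto simp: mult.assoc)
    qed
    obtain r1 r2 r3 where r: "[x1*r1 = n] (mod q)" "[x2*r2 = n] (mod q)" "[x3*r3 = n] (mod q)"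
      using div[OF nz(1)] div[OF nz(2)] div[OF nz(3)] by blast
    note R1 = recip_sum1[OF e(2,3) r w M] and R2 = recip_sum2[OF e(1,3) r w]
      and R3 = recip_sum3[OF e(3) r w]
    note S1 = slope_sum1[OF R1] and S2 = slope_sum2[OF R1 R2] and S3 = slope_sum3[OF R1 R2 R3]
    show ?thesis
      unfolding coll_line(1-3)
        etaq_line_point[OF nz(1) on(1) w M r(1)] etaq_line_point[OF nz(2) on(2) w M r(2)]
        etaq_line_point[OF nz(3) on(3) w M r(3)]
      using eta_line1[OF S1 S2] eta_line2[OF slope_sum_sq[OF S1 S2 S3 M] c_fourth] eta_line3[OF S3]
      by (rule coll.coll_line)
  qed
qed (auto simp: etaq_simps etaq_neg intro: coll.intros etaq_in_G)

lemma coll_T: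
  assumes "coll Q T R"
  shows "R = neg (tau Q)"
  using assms
proof cases
  case coll_Inf1
  then show ?thesis by (simp add: tau_Infinity)
next
  case coll_Inf3
  then have "Q = T" by (metis neg_neg neg_pt minus_zero)
  with coll_Inf3 show ?thesis by (simp add: tau_T)
next
  case (coll_line x1 x2 x3 l n)
  then have "[x2 = 0] (mod q)" "[l*x2 + n = 0] (mod q)"
    using pt_eq_iff by (metis cong_sym)+
  then have x2: "q dvd x2" and "q dvd l*x2 + n" by (simp_all add: cong_0_iff)
  then have n: "q dvd n" by (metis dvd_add_right_iff dvd_mult)
  have "[x1*x3 + x1*x2 + x3*x2 = - m - 2*l*n] (mod q)" using coll_line(5) by (simp add: ac_simps)
  from line_through_T(1)[OF this x2 n] show ?thesis by (simp add: coll_line)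
qed simp

lemma coll_secant:
  assumes "pt x1 y1 \<in> G" "pt x2 y2 \<in> G" "\<not> [x1 = x2] (mod q)"
  obtains R where "coll (pt x1 y1) (pt x2 y2) R"
proof -
  have "\<not> q dvd x2 - x1" using assms(3) by (simp add: cong_iff_dvd_diff dvd_diff_commute)
  then obtain d where d: "[d*(x2 - x1) = 1] (mod q)"
    using inverse_mod_q by (metis mult.commute)
  define l n where "l = d*(y2 - y1)" and "n = y1 - l*x1"
  have l: "[l = d*(y2 - y1)] (mod q)" by (simp add: l_def)
  have on: "on_curve x1 y1" "on_curve x2 y2" using assms by (simp_all add: pt_in_G)
  have "coll (pt x1 (l*x1 + n)) (pt x2 (l*x2 + n)) (pt (l^2 - x1 - x2) (l*(l^2 - x1 - x2) + n))"
    using secant_e2[OF d on l] secant_e3[OF d on l]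
    by (intro coll_line) (simp_all add: n_def)
  moreover have "pt x1 (l*x1 + n) = pt x1 y1" by (simp add: n_def)
  moreover have "pt x2 (l*x2 + n) = pt x2 y2"
    using secant_y[OF d l] by (simp add: pt_eq_iff n_def cong_sym_eq)
  ultimately show thesis using that by metis
qed

section \<open>Images of the iterates of eta\<close>

lemma etaq_iter_in_G: "P \<in> G \<Longrightarrow> (etaq ^^ j) P \<in> G"
  by (induction j) (simp_all add: etaq_in_G)

lemma etaq_iter_neg: "P \<in> G \<Longrightarrow> (etaq ^^ j) (neg P) = neg ((etaq ^^ j) P)"
  by (induction j) (simp_all add: etaq_neg etaq_iter_in_G)

lemma etaq_iter_Infinity: "(etaq ^^ j) Infinity = Infinity"
  by (induction j) (simp_all add: etaq_simps)

lemma coll_etaq_iter: "coll P Q R \<Longrightarrow> coll ((etaq ^^ j) P) ((etaq ^^ j) Q) ((etaq ^^ j) R)"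
  by (induction j) (simp_all add: coll_etaq)

lemma Infinity_in_image: "Infinity \<in> (etaq ^^ j) ` G"
  using etaq_iter_Infinity by (metis Infinity_in_G image_eqI)

lemma eta_iter_eq: "P \<in> G \<Longrightarrow> eta_iter q m i j P = Some ((etaq ^^ j) P)"
  by (induction j) (simp_all add: eta_iter_def eta_eq_etaq etaq_iter_in_G)

lemma image_etaq_iter_le:
  assumes "j \<le> k"
  shows "(etaq ^^ k) ` G \<subseteq> (etaq ^^ j) ` G"
proof
  fix Q assume "Q \<in> (etaq ^^ k) ` G"
  then obtain P where P: "P \<in> G" "Q = (etaq ^^ k) P" by blast
  have "(etaq ^^ k) P = (etaq ^^ j) ((etaq ^^ (k - j)) P)"
    using assms by (metis comp_apply funpow_add le_add_diff_inverse)
  then show "Q \<in> (etaq ^^ j) ` G" using P etaq_iter_in_G by blast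
qed

text \<open>Take preimages \<open>P\<close> of \<open>Q\<close> and \<open>S\<close> of
  \<open>T\<close>, and the third point \<open>R\<close> on their secant. Its image is collinear
  with \<open>Q\<close> and \<open>T\<close>, hence equals \<open>neg (tau Q)\<close>, and
  \<open>neg R\<close> is a preimage of \<open>tau Q\<close>. Where no secant is available,
  \<open>Q\<close> is \<open>Infinity\<close> or \<open>T\<close>, and \<open>tau\<close> exchanges
  these.\<close>

lemma tau_in_etaq_iter_image:
  assumes "T \<in> (etaq ^^ j) ` G" "Q \<in> (etaq ^^ j) ` G"
  shows "tau Q \<in> (etaq ^^ j) ` G"
proof -
  obtain S P where S: "S \<in> G" "T = (etaq ^^ j) S" and P: "P \<in> G" "Q = (etaq ^^ j) P"
    using assms by blast
  show ?thesis
  proof (cases "P = Infinity \<or> P = S \<or> P = neg S")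
    case True
    then have "Q = Infinity \<or> Q = T"
      using P(2) by (auto simp: etaq_iter_Infinity etaq_iter_neg[OF S(1)] S(2)[symmetric] neg_pt)
    then show ?thesis
      using assms(1) Infinity_in_image tau_Infinity tau_T by metis
  next
    case False
    have "S \<noteq> Infinity" using S(2) by (auto simp: etaq_iter_Infinity)
    then obtain x1 y1 x2 y2 where eq: "P = pt x1 y1" "S = pt x2 y2"
      using P(1) S(1) False by (metis G_cases)
    have "\<not> [x1 = x2] (mod q)"
    proof
      assume x: "[x1 = x2] (mod q)"
      have "on_curve x1 y1" "on_curve x2 y2" using P(1) S(1) eq by (simp_all add: pt_in_G)
      then have "on_curve x1 y1" "on_curve x1 y2"
        using on_curve_cong[OF x cong_refl] by simp_all
      then have "[y1^2 = y2^2] (mod q)" by (meson cong_sym cong_trans)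
      then show False
        using x False by (auto simp: cong_square_iff eq neg_pt pt_eq_iff)
    qed
    then obtain R where R: "coll P S R" using coll_secant P(1) S(1) unfolding eq by blast
    then have "R \<in> G" using coll_in_G by blast
    have "(etaq ^^ j) R = neg (tau Q)"
      using coll_T coll_etaq_iter[OF R, of j] P S by simp
    then have "tau Q = (etaq ^^ j) (neg R)"
      using \<open>R \<in> G\<close> P by (simp add: etaq_iter_neg neg_neg tau_in_G etaq_iter_in_G)
    then show ?thesis using \<open>R \<in> G\<close> neg_in_G by blast
  qed
qed

lemma finite_G: "finite G"
proof -
  have "G \<subseteq> insert Infinity ((\<lambda>(x, y). Affine x y) ` ({0..<q} \<times> {0..<q}))"
    by (auto simp: ec_points_def)
  then show ?thesis by (rule finite_subset) simp
qed

text \<open>Each step doubles the size: \<open>Q\<close> has exactly the two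
  \<open>etaq\<close>-preimages \<open>Q'\<close> and \<open>tau Q'\<close>, and with
  \<open>T\<close> among the images at level \<open>j\<close>, both are images at that
  level.\<close>

lemma card_etaq_iter_fibre:
  assumes "\<And>l. l < j \<Longrightarrow> T \<in> (etaq ^^ l) ` G" "Q \<in> (etaq ^^ j) ` G"
  shows "card {P \<in> G. (etaq ^^ j) P = Q} = 2 ^ j"
  using assms
proof (induction j arbitrary: Q)
  case 0
  then have "{P \<in> G. (etaq ^^ 0) P = Q} = {Q}" by auto
  then show ?case by simp
next
  case (Suc j)
  obtain S where S: "S \<in> G" "Q = (etaq ^^ Suc j) S" using Suc.prems(2) by blast
  define Q' where "Q' = (etaq ^^ j) S"
  have Q': "Q' \<in> G" "Q' \<in> (etaq ^^ j) ` G" "etaq Q' = Q"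
    using S by (simp_all add: Q'_def etaq_iter_in_G)
  have tau: "tau Q' \<in> (etaq ^^ j) ` G"
    using tau_in_etaq_iter_image[OF Suc.prems(1) Q'(2)] by simp
  have "{P \<in> G. (etaq ^^ Suc j) P = Q} =
      {P \<in> G. (etaq ^^ j) P = Q'} \<union> {P \<in> G. (etaq ^^ j) P = tau Q'}"
    using etaq_fibre[OF Q'(1)] etaq_iter_in_G etaq_tau Q' by auto
  moreover have "card {P \<in> G. (etaq ^^ j) P = Q'} = 2 ^ j"
    "card {P \<in> G. (etaq ^^ j) P = tau Q'} = 2 ^ j"
    using Suc.IH Suc.prems(1) Q'(2) tau by simp_all
  moreover have "{P \<in> G. (etaq ^^ j) P = Q'} \<inter> {P \<in> G. (etaq ^^ j) P = tau Q'} = {}"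
    using tau_neq Q'(1) by force
  ultimately show ?case using finite_G by (simp add: card_Un_disjoint)
qed

text \<open>\<open>G\<close> is partitioned into the fibres of level \<open>Suc j\<close>. Their
  size needs \<open>T\<close> only at the levels up to \<open>j\<close>, which follow from level
  \<open>j\<close> because the images are nested.\<close>

lemma card_G_eq:
  assumes "T \<in> (etaq ^^ j) ` G"
  shows "card G = 2 ^ Suc j * card ((etaq ^^ Suc j) ` G)"
proof -
  have T: "T \<in> (etaq ^^ l) ` G" if "l < Suc j" for l
    using image_etaq_iter_le[of l j] that assms by auto
  have "card G = (\<Sum>Q\<in>(etaq ^^ Suc j) ` G. card {P \<in> G. (etaq ^^ Suc j) P = Q})"
    unfolding card_eq_sum by (rule sum.image_gen[OF finite_G])
  also have "\<dots> = (\<Sum>Q\<in>(etaq ^^ Suc j) ` G. 2 ^ Suc j)"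
    using T by (intro sum.cong card_etaq_iter_fibre) auto
  finally show ?thesis by simp
qed

text \<open>Negation acts on the image. A fixed point other than \<open>Infinity\<close> is
  \<open>T\<close> or is mapped to \<open>T\<close>, and either would put \<open>T\<close> into the
  image, as \<open>etaq\<close> maps the image into itself.\<close>

lemma odd_card_etaq_iter_image:
  assumes "T \<notin> (etaq ^^ j) ` G"
  shows "odd (card ((etaq ^^ j) ` G))"
proof -
  define C where "C = (etaq ^^ j) ` G"
  have C: "C \<subseteq> G" "Infinity \<in> C" "T \<notin> C"
    using etaq_iter_in_G Infinity_in_image assms by (auto simp: C_def)
  have neg_C: "neg P \<in> C" if P: "P \<in> C" for P
  proof -
    obtain S where "S \<in> G" "P = (etaq ^^ j) S" using P by (auto simp: C_def)
    then show ?thesis unfolding C_def using etaq_iter_neg neg_in_G by (metis image_eqI)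
  qed
  have fixed: "P = Infinity" if P: "P \<in> C" "neg P = P" for P
  proof -
    have "etaq P \<in> (etaq ^^ Suc j) ` G" using P(1) by (auto simp: C_def)
    then have "etaq P \<in> C" using image_etaq_iter_le[of j "Suc j"] by (auto simp: C_def)
    then show ?thesis using neg_fixed[of P] P C by (metis subsetD)
  qed
  have "even (card (C - {Infinity}))"
  proof (rule even_card_involution[of _ neg])
    show "finite (C - {Infinity})" using finite_subset[OF C(1) finite_G] by simp
    fix P assume P: "P \<in> C - {Infinity}"
    then have "P \<in> G" "P \<in> C" using C(1) by auto
    then show "neg (neg P) = P" "neg P \<noteq> P" using P fixed neg_neg by auto
    then show "neg P \<in> C - {Infinity}" using \<open>P \<in> C\<close> neg_C by auto
  qed
  moreover have "card C = Suc (card (C - {Infinity}))"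
    using finite_subset[OF C(1) finite_G] C(2) by (rule card.remove)
  ultimately show ?thesis unfolding C_def by simp
qed

lemma card_G_exact:
  assumes "card G = 2 ^ r"
  shows "(etaq ^^ r) ` G = {Infinity}" "T \<in> (etaq ^^ (r - 1)) ` G" "r > 0"
proof -
  have bound: "j < r" if "T \<in> (etaq ^^ j) ` G" for j
  proof -
    have "(2::nat) ^ Suc j dvd 2 ^ r" using card_G_eq[OF that] assms by (metis dvd_triv_left)
    then show ?thesis by (auto dest: dvd_imp_le simp del: power_Suc)
  qed
  \<comment> \<open>The last level at which \<open>T\<close> is an image. It exists since
    \<open>T\<close> is an image at level 0 and \<open>bound\<close> limits the levels; the next
    image has odd size dividing a power of 2, so it is a single point.\<close>
  obtain j where j: "T \<in> (etaq ^^ j) ` G" "T \<notin> (etaq ^^ Suc j) ` G"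
  proof (rule ccontr)
    assume "\<not> thesis"
    then have step: "T \<in> (etaq ^^ Suc j) ` G" if "T \<in> (etaq ^^ j) ` G" for j
      using \<open>T \<in> (etaq ^^ j) ` G\<close> \<open>\<And>j. \<lbrakk>T \<in> (etaq ^^ j) ` G; T \<notin> (etaq ^^ Suc j) ` G\<rbrakk> \<Longrightarrow> thesis\<close>
      by metis
    have "T \<in> (etaq ^^ r) ` G"
    proof (induction r)
      case 0
      show ?case by simp
    qed (rule step)
    then show False using bound by blast
  qed
  have odd: "odd (card ((etaq ^^ Suc j) ` G))" using j(2) by (rule odd_card_etaq_iter_image)
  have "card ((etaq ^^ Suc j) ` G) dvd 2 ^ r" using card_G_eq[OF j(1)] assms by (metis dvd_triv_right)
  then have 1: "card ((etaq ^^ Suc j) ` G) = 1"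
    using odd by (metis divides_primepow_nat even_power even_numeral not_gr_zero power_0 two_is_prime_nat)
  then have "(2::nat) ^ r = 2 ^ Suc j" using card_G_eq[OF j(1)] assms by simp
  then have r: "r = Suc j" by (simp only: power_inject_exp)
  show "(etaq ^^ r) ` G = {Infinity}"
    using 1 Infinity_in_image[of r] unfolding r by (metis card_1_singletonE singletonD)
  show "T \<in> (etaq ^^ (r - 1)) ` G" "r > 0" using j(1) r by simp_all
qed

lemma etaq_iter_generator:
  assumes "card G = 2 ^ r" "P \<in> G" "P \<notin> etaq ` G"
  shows "(etaq ^^ (r - 1)) P = T"
proof -
  note r = card_G_exact[OF assms(1)]
  let ?K = "{P \<in> G. (etaq ^^ (r - 1)) P = Infinity}"
  have rS: "etaq ^^ r = (etaq ^^ (r - 1)) \<circ> etaq" "etaq ^^ r = etaq \<circ> (etaq ^^ (r - 1))"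
    using r(3) by (metis Suc_diff_1 funpow_Suc_right, metis Suc_diff_1 funpow.simps(2))
  have "card G = 2 * card (etaq ` G)"
    using card_G_eq[of 0] by simp
  then have 1: "card (etaq ` G) = 2 ^ (r - 1)"
    using assms(1) r(3) by (cases r) auto
  have "card ?K = 2 ^ (r - 1)"
    using r(2) image_etaq_iter_le[of _ "r - 1"] Infinity_in_image
    by (intro card_etaq_iter_fibre) (auto dest!: less_imp_le)
  moreover have "etaq ` G \<subseteq> ?K"
    using r(1) etaq_in_G unfolding rS(1) by (auto simp: image_iff)
  ultimately have "etaq ` G = ?K"
    using 1 finite_G by (intro card_subset_eq) auto
  then have "(etaq ^^ (r - 1)) P \<noteq> Infinity" using assms(2,3) by blast
  moreover have "etaq ((etaq ^^ (r - 1)) P) = etaq Infinity"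
    using r(1) assms(2) unfolding rS(2) by (auto simp: etaq_simps)
  ultimately show ?thesis
    using etaq_fibre[of Infinity "(etaq ^^ (r - 1)) P"] assms(2)
    by (auto simp: tau_Infinity etaq_iter_in_G)
qed

section \<open>Square first coordinates, and point counts for primes \<open>d^2 + 1\<close>\<close>

lemma etaq_image_QuadRes:
  assumes "Affine x y \<in> etaq ` G"
  shows "QuadRes q x"
proof -
  obtain P where P: "P \<in> G" "etaq P = Affine x y" using assms by auto
  from P(1) show ?thesis
  proof (cases P rule: G_cases)
    case (pt x' y')
    obtain t where t: "[x'*t = c*y'] (mod q)" using slope_exists pt(2) .
    have "x = t^2 mod q"
      using P(2) etaq_simps(3)[OF pt(2) t] by (simp add: pt(1)) (simp add: pt_def)
    then have "[t^2 = x] (mod q)" by simp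
    then show ?thesis unfolding QuadRes_def by blast
  qed (use P(2) in \<open>auto simp: etaq_simps\<close>)
qed

lemma T_in_etaq2_image:
  assumes "[a^4 = m] (mod q)"
  shows "T \<in> (etaq ^^ 2) ` G"
proof -
  have i: "q dvd i^2 - (- 1)" and m: "q dvd a^4 - m" and c: "q dvd 2*c - (1 - i)"
    using i_square assms two_c by (simp_all add: cong_iff_dvd_diff)
  have "\<not> q dvd a^4" using assms m_nonzero cong_dvd_iff by blast
  then have a: "\<not> q dvd a" by (auto simp: numeral_eq_Suc)
  then have a2: "\<not> q dvd a^2" by (simp add: power2_eq_square dvd_mult_q_iff)
  have "\<not> q dvd i"
  proof
    assume "q dvd i"
    then have "q dvd i^2" by (simp add: power2_eq_square)
    then have "q dvd 1" using i by (simp add: dvd_add_right_iff)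
    then show False using q_gt_2 by simp
  qed
  then have ia: "\<not> q dvd i*a^2" using a2 by (simp add: dvd_mult_q_iff)
  \<comment> \<open>The chain is explicit: this point has \<open>t = a\<close> and goes to
    \<open>(a^2, 0)\<close>, which lies on the curve because \<open>a^4 = m\<close>, and then to
    \<open>T\<close>.\<close>
  have on: "on_curve (i*a^2) ((i - 1)*a^3)"
  proof -
    have eq: "((i - 1)*a^3)^2 - ((i*a^2)^3 - m*(i*a^2)) =
      (a^6 - i*a^6) * (i^2 - (- 1)) + - (i*a^2) * (a^4 - m)"
      by Groebner_Basis.algebra
    show ?thesis unfolding cong_iff_dvd_diff by (subst eq) (intro i m dvd_add dvd_mult)
  qed
  have slope: "[i*a^2*a = c*((i - 1)*a^3)] (mod q)"
  proof -
    have "2 * (i*a^2*a - c*((i - 1)*a^3)) =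
      (- (i - 1)*a^3) * (2*c - (1 - i)) + a^3 * (i^2 - (- 1))"
      by Groebner_Basis.algebra
    then have "q dvd 2 * (i*a^2*a - c*((i - 1)*a^3))" using i c by (metis dvd_add dvd_mult)
    then show ?thesis
      using coprime_2_q by (metis cong_iff_dvd_diff coprime_commute coprime_dvd_mult_right_iff)
  qed
  have "etaq (pt (i*a^2) ((i - 1)*a^3)) = pt (a^2) (a*(i*a^2 - a^2) - (i - 1)*a^3)"
    using ia slope by (rule etaq_simps(3))
  also have "a*(i*a^2 - a^2) - (i - 1)*a^3 = 0" by Groebner_Basis.algebra
  finally have "etaq (etaq (pt (i*a^2) ((i - 1)*a^3))) = T"
    using etaq_simps(3)[OF a2, of 0 0] by simp
  moreover have "pt (i*a^2) ((i - 1)*a^3) \<in> G" using on by (simp add: pt_in_G)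
  ultimately show ?thesis by (force simp: numeral_2_eq_2)
qed

lemma card_G_le: "int (card G) \<le> 2 * q + 1"
proof -
  have "jacobsthal q m \<le> (\<Sum>x\<in>{0..<q}. 1)"
    unfolding jacobsthal_def by (intro sum_mono) (simp add: Legendre_def)
  then show ?thesis using card_ec_points[OF prime_q q_gt_2, of m] q_gt_2 by simp
qed

text \<open>The halves of the two Jacobsthal sums have squares adding up to \<open>d^2 + 1\<close>,
  so the half belonging to \<open>m\<close> is 1, -1, \<open>d\<close> or \<open>- d\<close>. As
  \<open>T\<close> is an image at level 2, 8 divides the number of points, which selects -1.\<close>

lemma card_G_one_plus_square:
  assumes "[a^4 = m] (mod q)" "\<not> QuadRes q g" "q = d^2 + 1" "4 dvd d"
  shows "int (card G) = q - 1"
proof -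
  define J where "J = jacobsthal q"
  have "QuadRes q (- 1)" using i_square by (auto simp: QuadRes_def)
  moreover have "QuadRes q m"
    using assms(1) by (auto simp: QuadRes_def power_mult[symmetric] intro!: exI[of _ "a^2"])
  ultimately have J: "(J m)^2 + (J g)^2 = 4 * q"
    unfolding J_def using jacobsthal_sum_of_squares prime_q q_gt_2 assms(2) m_nonzero by blast
  then have "even (J m)" "even (J g)"
    using even_if_sum_squares_dvd_4[of "J m" "J g" q] even_if_sum_squares_dvd_4[of "J g" "J m" q]
    by (simp_all add: add.commute)
  then obtain s t where st: "J m = 2 * s" "J g = 2 * t" by (auto elim!: evenE)
  then have "s^2 + t^2 = d^2 + 1" using J assms(3) by (simp add: power_mult_distrib)
  then have s: "\<bar>s\<bar> = 1 \<or> \<bar>s\<bar> = \<bar>d\<bar>"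
    using prime_q assms(3) by (intro sum_two_squares_one_plus_square) auto
  have card: "int (card G) = q + 1 + 2 * s"
    using card_ec_points[OF prime_q q_gt_2, of m] st by (simp add: J_def)
  have "8 dvd card G"
    using card_G_eq[OF T_in_etaq2_image[OF assms(1)]] by simp
  then have "8 dvd q + 1 + 2 * s" unfolding card[symmetric] by presburger
  moreover obtain e where "d = 4 * e" using assms(4) by blast
  moreover from this have "q + 1 + 2 * s = 8 * (2 * e^2) + 2 * (1 + s)"
    using assms(3) by (simp add: power_mult_distrib)
  ultimately have "8 dvd 2 * (1 + s)" by (metis dvd_add_right_iff dvd_triv_left)
  \<comment> \<open>This excludes 1, and also \<open>d\<close> and \<open>- d\<close>, which are
    multiples of 4.\<close>
  then have "4 dvd 1 + s" by presburger
  with s \<open>d = 4 * e\<close> have "s = - 1" by (auto simp: abs_if split: if_splits) presburger+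
  then show ?thesis using card by simp
qed

end

section \<open>Reduction modulo a divisor\<close>

fun reduce :: "int \<Rightarrow> point \<Rightarrow> point" where
  "reduce q Infinity = Infinity"
| "reduce q (Affine x y) = Affine (x mod q) (y mod q)"

lemma eta_iter_Suc: "eta_iter n m i (Suc j) P = Option.bind (eta_iter n m i j P) (eta n m i)"
  by (simp add: eta_iter_def)

context cm_curve
begin

text \<open>The case distinctions of the addition could come out differently modulo \<open>N\<close>
  and modulo \<open>q\<close>. But the result \<open>Infinity\<close> forces both coordinates to
  vanish modulo \<open>N\<close>, and a successful division makes \<open>2*x\<close> coprime to
  \<open>N\<close>, hence nonzero modulo \<open>q\<close>.\<close>

lemma eta_reduce:
  assumes "q dvd N" "N > 1" "odd N" "[i^2 = - 1] (mod N)" "eta N m i P = Some R"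
  shows "eta q m i (reduce q P) = Some (reduce q R)"
proof (cases P)
  case Infinity
  then show ?thesis using assms(5) by (auto simp: eta_def)
next
  case (Affine x y)
  define x' y' where "x' = (- x) mod N" and "y' = (i * y) mod N"
  have x': "[x' = - x] (mod N)" and y': "[y' = i * y] (mod N)" by (simp_all add: x'_def y'_def)
  have red: "reduce q P = pt x y" by (simp add: Affine pt_def)
  have x0: "N dvd x" if "[x = x'] (mod N)"
  proof -
    have "[x = - x] (mod N)" using that x' by (rule cong_trans)
    then have "N dvd 2 * x" by (simp add: cong_iff_dvd_diff)
    then show ?thesis using assms(3) by (simp add: coprime_dvd_mult_right_iff)
  qed
  \<comment> \<open>For \<open>e\<close> equal to 1 or -1, \<open>e + i\<close> is invertible: its
    product with \<open>e - i\<close> is 2 modulo \<open>N\<close>, and \<open>N\<close> is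
    odd.\<close>
  have y0: "N dvd y" if "N dvd (e + i) * y" "e^2 = 1" for e
  proof -
    have "(e - i) * ((e + i) * y) + y * (i^2 - (- 1)) = (e^2 + 1) * y" by Groebner_Basis.algebra
    moreover have "N dvd i^2 - (- 1)" using assms(4) by (simp add: cong_iff_dvd_diff)
    ultimately have "N dvd (e^2 + 1) * y" using that(1) by (metis dvd_add dvd_mult)
    then show ?thesis using assms(3) that(2) by (simp add: coprime_dvd_mult_right_iff)
  qed
  show ?thesis
  proof (cases "[x = x'] (mod N) \<and> [y = - y'] (mod N)")
    case True
    then have R: "R = Infinity" using assms(5) by (simp add: Affine eta_def x'_def y'_def)
    have "[y = - (i * y)] (mod N)"
      using True y' by (meson cong_minus_minus_iff cong_trans)
    then have "N dvd (1 + i) * y" by (simp add: cong_iff_dvd_diff algebra_simps)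
    then have "N dvd y" by (rule y0) simp
    moreover have "N dvd x" using x0 True by blast
    ultimately have "reduce q P = T"
      using assms(1) unfolding red pt_eq_iff cong_0_iff by (blast intro: dvd_trans)
    then show ?thesis using eta_T R by simp
  next
    case False
    \<comment> \<open>A tangent would require \<open>y = i*y\<close>, hence \<open>y = 0\<close>,
      which belongs to the excluded case with result \<open>Infinity\<close>.\<close>
    have not_tangent: "\<not> ([x = x'] (mod N) \<and> [y = y'] (mod N))"
    proof
      assume *: "[x = x'] (mod N) \<and> [y = y'] (mod N)"
      then have "[y = i * y] (mod N)" using y' by (meson cong_trans)
      then have "N dvd i * y - y" by (metis cong_iff_dvd_diff cong_sym)
      then have "N dvd (- 1 + i) * y" by (simp add: algebra_simps)
      then have "N dvd y" by (rule y0) simp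
      then have "[y = - y'] (mod N)"
        using * by (metis cong_0_iff cong_dvd_iff cong_sym cong_trans dvd_minus_iff)
      then show False using False * by blast
    qed
    then have "coprime (x' - x) N"
      using assms(5) False
      by (auto simp: Affine eta_def x'_def[symmetric] y'_def[symmetric] div_mod_def split: if_splits)
    moreover have "[x' - x = - (2 * x)] (mod N)"
      using cong_diff[OF x' cong_refl[of x]] by simp
    ultimately have cop: "coprime (2 * x) N"
      by (metis cong_imp_coprime coprime_minus_left_iff)
    define l where "l = (1 - i) * y * modular_inverse N (2 * x)"
    have R: "R = Affine (l^2 mod N) ((l * (x - l^2) - y) mod N)"
      using eta_Affine[OF assms(2,4) cop, of m y] assms(5) by (simp add: Affine l_def)
    have "coprime (2 * x) q" using cop assms(1) by (metis coprime_divisors dvd_refl)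
    then have x: "\<not> q dvd x" by (simp add: coprime_q_iff dvd_mult_q_iff)
    have "[modular_inverse N (2 * x) * (2 * x) = 1] (mod q)"
      using cong_modular_inverse2[OF cop] assms(1) by (rule cong_dvd_modulus)
    from cong_scalar_left[OF this, of "(1 - i) * y"] have "[2 * (x * l) = (1 - i) * y] (mod q)"
      by (simp add: l_def ac_simps)
    also have "[(1 - i) * y = 2 * c * y] (mod q)" by (intro cong_mult cong_sym[OF two_c] cong_refl)
    finally have "[2 * (x * l) = 2 * (c * y)] (mod q)" by (simp add: mult.assoc)
    then have "[x * l = c * y] (mod q)" using coprime_2_q by (simp only: cong_mult_lcancel)
    from eta_pt[OF x this] show ?thesis
      unfolding red R using assms(1) by (simp add: pt_def mod_mod_cancel)
  qed
qed

lemma eta_iter_reduce: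
  assumes "q dvd N" "N > 1" "odd N" "[i^2 = - 1] (mod N)" "eta_iter N m i j P = Some R"
  shows "eta_iter q m i j (reduce q P) = Some (reduce q R)"
  using assms(5)
proof (induction j arbitrary: R)
  case 0
  then show ?case by (simp add: eta_iter_def)
next
  case (Suc j)
  then obtain S where "eta_iter N m i j P = Some S" "eta N m i S = Some R"
    by (auto simp: eta_iter_Suc bind_eq_Some_conv)
  then show ?case
    using Suc.IH eta_reduce[OF assms(1-4)] by (simp add: eta_iter_Suc)
qed

text \<open>Reaching \<open>T\<close> after \<open>r - 1\<close> steps makes the number of points a
  positive multiple of \<open>2 ^ r\<close>, one power more than the number of steps.\<close>

lemma power_le_if_eta_iter_eq_zero:
  assumes "P \<in> G" "eta_iter q m i (r - 1) P = Some (Affine 0 0)" "r > 0"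
  shows "2 ^ r \<le> 2 * q + 1"
proof -
  have "T \<in> (etaq ^^ (r - 1)) ` G"
    using assms(1,2) eta_iter_eq T_eq by (metis image_eqI option.inject)
  then have "card G = 2 ^ r * card ((etaq ^^ r) ` G)" using card_G_eq assms(3) by fastforce
  moreover have "card ((etaq ^^ r) ` G) \<ge> 1"
    using finite_G Infinity_in_image by (metis One_nat_def Suc_leI card_gt_0_iff empty_iff finite_imageI)
  ultimately have "2 ^ r \<le> card G" by simp
  then have "2 ^ r \<le> int (card G)" by (metis of_nat_le_iff of_nat_numeral of_nat_power)
  then show ?thesis using card_G_le by linarith
qed

end

section \<open>Primality criterion for \<open>2 ^ 2 ^ k + 1\<close>\<close>

lemma cm_curve_exists:
  fixes q m i :: int
  assumes "prime q" "odd q" "[i^2 = - 1] (mod q)" "\<not> q dvd m"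
  obtains c where "cm_curve q m i c"
proof -
  \<comment> \<open>This is the inverse of 2 modulo \<open>q\<close>.\<close>
  define h where "h = (q + 1) div 2"
  have "2 * h = q + 1" using assms(2) unfolding h_def by presburger
  then have "2 * ((1 - i) * h) - (1 - i) = (1 - i) * q" by Groebner_Basis.algebra
  then have "[2 * ((1 - i) * h) = 1 - i] (mod q)" by (simp add: cong_iff_dvd_diff)
  with assms show thesis using that by (simp add: cm_curve_def)
qed

theorem theorem3p1:
  fixes k :: nat and N m i x y :: int
  assumes "2 \<le> k"
    and "N = 2 ^ (2 ^ k) + 1"
    and "coprime m N"
    and "\<exists>a. [a ^ 4 = m] (mod N)"
    and "[i ^ 2 = - 1] (mod N)"
    and "Affine x y \<in> ec_points N m"
    and "\<not> QuadRes N x"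
  shows "prime N \<longleftrightarrow> eta_iter N m i (2 ^ k - 1) (Affine x y) = Some (Affine 0 0)"
proof
  have odd: "odd N" using assms(1,2) by simp
  have N: "N > 1" using assms(2) by simp
  have "(2::nat) ^ 2 \<le> 2 ^ k" using assms(1) by (intro power_increasing) auto
  then have r: "(4::nat) \<le> 2 ^ k" by simp
  {
    assume prime: "prime N"
    then have "\<not> N dvd m" using assms(3) N by (metis coprime_common_divisor dvd_refl not_prime_unit)
    then obtain c where "cm_curve N m i c" using cm_curve_exists prime odd assms(5) by blast
    then interpret cm_curve N m i c .
    obtain a where a: "[a ^ 4 = m] (mod N)" using assms(4) by blast
    define d :: int where "d = 2 ^ 2 ^ (k - 1)"
    have "(2::nat) ^ k = 2 ^ (k - 1) * 2" using assms(1) by (cases k) auto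
    then have "N = d^2 + 1" by (simp add: assms(2) d_def power_mult)
    moreover have "4 dvd d"
    proof -
      have "(2::nat) ^ 1 \<le> 2 ^ (k - 1)" using assms(1) by (intro power_increasing) auto
      then have "(2::int) ^ 2 dvd d" unfolding d_def by (intro le_imp_power_dvd) simp
      then show ?thesis by simp
    qed
    \<comment> \<open>The nonresidue needed for the point count is the first coordinate
      \<open>x\<close> of the given point.\<close>
    ultimately have "int (card G) = N - 1" using card_G_one_plus_square a assms(7) by blast
    then have "int (card G) = int (2 ^ 2 ^ k)" using assms(2) by simp
    then have "card G = 2 ^ 2 ^ k" by (simp only: of_nat_eq_iff)
    moreover have "Affine x y \<notin> etaq ` G" using etaq_image_QuadRes assms(7) by blast
    ultimately have "(etaq ^^ (2 ^ k - 1)) (Affine x y) = T"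
      using assms(6) by (intro etaq_iter_generator)
    then show "eta_iter N m i (2 ^ k - 1) (Affine x y) = Some (Affine 0 0)"
      by (simp only: eta_iter_eq[OF assms(6)] T_eq)
  }
  {
    assume eta: "eta_iter N m i (2 ^ k - 1) (Affine x y) = Some (Affine 0 0)"
    show "prime N"
    proof (rule ccontr)
      assume "\<not> prime N"
      then obtain q where q: "prime q" "q dvd N" "q^2 \<le> N" using small_prime_divisor N by blast
      have "odd q" using odd q(2) by (metis dvd_trans)
      moreover have "[i^2 = - 1] (mod q)" using assms(5) q(2) by (rule cong_dvd_modulus)
      moreover have "\<not> q dvd m"
        using assms(3) q(1,2) by (metis coprime_common_divisor not_prime_unit)
      ultimately obtain c where "cm_curve q m i c" using cm_curve_exists q(1) by blast
      then interpret cm_curve q m i c .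
      have "[y^2 = x^3 - m*x] (mod q)"
        using assms(6) q(2) by (auto simp: ec_points_def intro: cong_dvd_modulus)
      then have "reduce q (Affine x y) \<in> G" by (simp add: pt_in_G flip: pt_def)
      moreover have "eta_iter q m i (2 ^ k - 1) (reduce q (Affine x y)) = Some (Affine 0 0)"
        using eta_iter_reduce[OF q(2) N odd assms(5) eta] by simp
      ultimately have le: "2 ^ 2 ^ k \<le> 2 * q + 1" by (rule power_le_if_eta_iter_eq_zero) simp
      define A :: int where "A = 2 ^ 2 ^ k"
      have "(2::int) ^ 4 \<le> A" unfolding A_def using r by (intro power_increasing) auto
      then have A: "A \<ge> 16" by simp
      \<comment> \<open>With \<open>q^2 \<le> A + 1\<close>, squaring
        \<open>A - 1 \<le> 2 * q\<close> bounds a quadratic in \<open>A\<close> by a linear term,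
        which fails once \<open>A \<ge> 16\<close>.\<close>
      have "(A - 1)^2 \<le> (2 * q)^2" using le A by (intro power_mono) (simp_all add: A_def)
      also have "\<dots> \<le> 4 * (A + 1)" using q(3) by (simp add: power_mult_distrib assms(2) A_def)
      finally have "A * (A - 6) \<le> 3" by (simp add: power2_eq_square algebra_simps)
      moreover have "16 * 10 \<le> A * (A - 6)" using A by (intro mult_mono) auto
      ultimately show False by simp
    qed
  }
qed

end
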